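(* For each $n$, consider the model $y_i=x_i'\beta_0+\sigma\epsilon_i$ $(i=1,\dots,n)$ with fixed regressors $x_i\in\mathbb{R}^p$ normalized so that $n^{-1}\sum_{i=1}^nx_{ij}^2=1$ $(j=1,\dots,p)$, $\sigma>0$, $T=\mathrm{supp}(\beta_0)$ having $s$ elements with $1\le s<n$, and errors $\epsilon_i$ independent with law $F_0=N(0,1)$. Fix $c>1$ and let $\bar c=(c+1)/(c-1)$. Suppose that: (RE) there exist finite constants $n_0>0$ and $\kappa>0$ such that $\kappa_{\bar c}\ge\kappa$ and $\tilde\kappa_{\bar c}\ge\kappa$ for all $n>n_0$; (G) $\log^2(p/\alpha)\log(1/\alpha)=o(n)$ and $p/\alpha\to\infty$ as $n\to\infty$; and $(s/n)\log(p/\alpha)\to0$ as $n\to\infty$. Let $\lambda$ be either $\lambda=c\,\Lambda_\Phi(1-\alpha\mid X)$ (exact option) or $\lambda=c\,n^{1/2}\Phi^{-1}(1-\alpha/2p)$ (asymptotic option), and let $\hat\beta$ be the square-root lasso estimator with penalty level $\lambda$. Then there is an $o(1)$ term such that with probability at least $1-\alpha-o(\alpha)$, $$\kappa\|\hat\beta-\beta_0\|_2\le\|\hat\beta-\beta_0\|_{2,n}\le C_n\,\sigma\Big\{\frac{2s\log(2p/\alpha)}{n}\Big\}^{1/2},\qquad C_n=\frac{2(1+c)}{\kappa\{1-o(1)\}}.$$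
   Context: Asymptotics: $n\to\infty$ and $p=p_n\to\infty$; $s=s_n$ may tend to infinity, and all parameters ($\beta_0,\sigma$, the design, $\alpha=\alpha_n$) may depend on $n$. The level $0<\alpha<1$ is bounded away from $1$ but may approach $0$ as $n$ grows. $o(\cdot)$ is with respect to $n\to\infty$. Notation: $E_n(f)=n^{-1}\sum_{i=1}^nf(z_i)$. $\Phi$ is the standard normal distribution function. $\delta_T$ keeps the coordinates of $\delta$ in $T$ and sets the others to $0$. The prediction norm is $\|\delta\|_{2,n}=[n^{-1}\sum_i(x_i'\delta)^2]^{1/2}$. Square-root lasso: $\hat\beta\in\arg\min_{\beta\in\mathbb{R}^p}\{n^{-1}\sum_i(y_i-x_i'\beta)^2\}^{1/2}+\frac\lambda n\|\beta\|_1$ (any minimizer). $\Lambda_\Phi(1-\alpha\mid X)$ is the $(1-\alpha)$-quantile, for the fixed design $X$, of $n\|E_n(x\xi)\|_\infty/\{E_n(\xi^2)\}^{1/2}$, where $\xi_1,\dots,\xi_n$ are i.i.d. $N(0,1)$ and $E_n(x\xi)=n^{-1}\sum_ix_i\xi_i$. Restricted eigenvalues: $\Delta_{\bar c}=\{\delta\in\mathbb{R}^p:\|\delta_{T^c}\|_1\le\bar c\|\delta_T\|_1,\ \delta\ne0\}$, $\kappa_{\bar c}=\min_{\delta\in\Delta_{\bar c}}s^{1/2}\|\delta\|_{2,n}/\|\delta_T\|_1$, $\tilde\kappa_{\bar c}=\min_{\delta\in\Delta_{\bar c}}\|\delta\|_{2,n}/\|\delta\|_2$. *)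

theory Defs
  imports "HOL-Probability.Probability" "HOL-Library.Landau_Symbols"
begin

(* The dimension p varies with the sample size, so a vector of R^p is a function nat => real of which
   only the coordinates j < p are ever inspected; a design x gives the row x i for i < n. *)

definition emp_mean :: "nat \<Rightarrow> (nat \<Rightarrow> real) \<Rightarrow> real" where
  "emp_mean n f = (\<Sum>i<n. f i) / real n"

definition inner_p :: "nat \<Rightarrow> (nat \<Rightarrow> real) \<Rightarrow> (nat \<Rightarrow> real) \<Rightarrow> real" where
  "inner_p p u v = (\<Sum>j<p. u j * v j)"

definition l1_norm :: "nat \<Rightarrow> (nat \<Rightarrow> real) \<Rightarrow> real" where
  "l1_norm p d = (\<Sum>j<p. \<bar>d j\<bar>)"

definition l2_norm :: "nat \<Rightarrow> (nat \<Rightarrow> real) \<Rightarrow> real" where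
  "l2_norm p d = L2_set d {..<p}"

(* only meaningful for p > 0 *)
definition linf_norm :: "nat \<Rightarrow> (nat \<Rightarrow> real) \<Rightarrow> real" where
  "linf_norm p d = (MAX j\<in>{..<p}. \<bar>d j\<bar>)"

definition pred_norm :: "nat \<Rightarrow> nat \<Rightarrow> (nat \<Rightarrow> nat \<Rightarrow> real) \<Rightarrow> (nat \<Rightarrow> real) \<Rightarrow> real" where
  "pred_norm n p x d = sqrt (emp_mean n (\<lambda>i. (inner_p p (x i) d)\<^sup>2))"

definition supp :: "nat \<Rightarrow> (nat \<Rightarrow> real) \<Rightarrow> nat set" where
  "supp p b = {j. j < p \<and> b j \<noteq> 0}"

definition coord_restrict :: "nat set \<Rightarrow> (nat \<Rightarrow> real) \<Rightarrow> nat \<Rightarrow> real" where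
  "coord_restrict T d = (\<lambda>j. if j \<in> T then d j else 0)"

definition restr_cone :: "nat \<Rightarrow> nat set \<Rightarrow> real \<Rightarrow> (nat \<Rightarrow> real) set" where
  "restr_cone p T cbar =
     {d. l1_norm p (coord_restrict (- T) d) \<le> cbar * l1_norm p (coord_restrict T d)
         \<and> (\<exists>j<p. d j \<noteq> 0)}"

(* For nonempty T, both infima are minima: the quotients are homogeneous of degree 0, so it suffices
   to take d with unit norm, and these form a compact part of the cone. *)

definition re_kappa :: "nat \<Rightarrow> nat \<Rightarrow> (nat \<Rightarrow> nat \<Rightarrow> real) \<Rightarrow> nat set \<Rightarrow> real \<Rightarrow> real" where
  "re_kappa n p x T cbar =
     (INF d\<in>restr_cone p T cbar.
        sqrt (real (card T)) * pred_norm n p x d / l1_norm p (coord_restrict T d))"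

definition re_kappa_tilde :: "nat \<Rightarrow> nat \<Rightarrow> (nat \<Rightarrow> nat \<Rightarrow> real) \<Rightarrow> nat set \<Rightarrow> real \<Rightarrow> real" where
  "re_kappa_tilde n p x T cbar =
     (INF d\<in>restr_cone p T cbar. pred_norm n p x d / l2_norm p d)"

definition sqrt_lasso_objective ::
    "nat \<Rightarrow> nat \<Rightarrow> (nat \<Rightarrow> nat \<Rightarrow> real) \<Rightarrow> (nat \<Rightarrow> real) \<Rightarrow> real \<Rightarrow> (nat \<Rightarrow> real) \<Rightarrow> real" where
  "sqrt_lasso_objective n p x y lam b =
     sqrt (emp_mean n (\<lambda>i. (y i - inner_p p (x i) b)\<^sup>2)) + lam / real n * l1_norm p b"

definition is_sqrt_lasso ::
    "nat \<Rightarrow> nat \<Rightarrow> (nat \<Rightarrow> nat \<Rightarrow> real) \<Rightarrow> (nat \<Rightarrow> real) \<Rightarrow> real \<Rightarrow> (nat \<Rightarrow> real) \<Rightarrow> bool" where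
  "is_sqrt_lasso n p x y lam b \<longleftrightarrow> is_arg_min (sqrt_lasso_objective n p x y lam) (\<lambda>_. True) b"

abbreviation std_normal_cdf :: "real \<Rightarrow> real" where
  "std_normal_cdf \<equiv> cdf std_normal_distribution"

definition quantile :: "real measure \<Rightarrow> real \<Rightarrow> real" where
  "quantile N u = Inf {t. u \<le> cdf N t}"

definition score_stat :: "nat \<Rightarrow> nat \<Rightarrow> (nat \<Rightarrow> nat \<Rightarrow> real) \<Rightarrow> (nat \<Rightarrow> real) \<Rightarrow> real" where
  "score_stat n p x \<xi> =
     real n * linf_norm p (\<lambda>j. emp_mean n (\<lambda>i. x i j * \<xi> i)) / sqrt (emp_mean n (\<lambda>i. (\<xi> i)\<^sup>2))"

definition Lambda_Phi :: "nat \<Rightarrow> nat \<Rightarrow> (nat \<Rightarrow> nat \<Rightarrow> real) \<Rightarrow> real \<Rightarrow> real" where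
  "Lambda_Phi n p x u =
     quantile (distr (PiM {..<n} (\<lambda>_. std_normal_distribution)) borel (score_stat n p x)) u"

end

theory Submission
  imports Defs
begin

text \<open>Deterministic part: if \<open>\<lambda>\<close> dominates \<open>c\<close> times the self-normalized score, then minimality and
  Cauchy--Schwarz place the estimation error in the restricted cone, and the restricted eigenvalue
  conditions bound its prediction norm by
  \<open>2 (1 + 1 / c) \<rho> \<sigma> E\<^sub>n(\<epsilon>\<^sup>2)\<^bsup>1/2\<^esup>\<close> up to a factor \<open>1 + O(\<rho>\<^sup>2)\<close>, where \<open>\<rho> = \<lambda> \<surd>s / (n \<kappa>)\<close>.

  Probabilistic part: \<open>E\<^sub>n(\<epsilon>\<^sup>2)\<close> lies within \<open>r\<close> of \<open>1\<close> by a Chernoff bound, and on that event each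
  coordinate of the score is a standard normal variable inflated by at most \<open>(1 - r)\<^bsup>-1/2\<^esup>\<close>. The
  growth condition leaves room for a radius \<open>r\<close> with failure probability \<open>o(\<alpha>)\<close> and
  \<open>r log (p / \<alpha>) \<rightarrow> 0\<close>. The latter keeps the normal tail at its \<open>\<alpha> / 2p\<close> quantile unchanged up to a
  factor \<open>1 + o(1)\<close>, so a union bound over the coordinates validates the asymptotic penalty. The same
  union bound shows that the exact penalty is not asymptotically larger.\<close>

section \<open>The standard normal distribution\<close>

lemma std_normal_density_antimono:
  assumes "0 \<le> a" "a \<le> b"
  shows "std_normal_density b \<le> std_normal_density a"
  using assms by (simp add: std_normal_density_def divide_right_mono power_mono)

text \<open>The density decreases on the nonnegative half-line, so its integral over
  \<open>{a<..b}\<close> is squeezed between the length times either end value.\<close>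

lemma std_normal_cdf_diff_bounds:
  assumes "0 \<le> a" "a \<le> b"
  shows "(b - a) * std_normal_density b \<le> std_normal_cdf b - std_normal_cdf a"
    and "std_normal_cdf b - std_normal_cdf a \<le> (b - a) * std_normal_density a"
proof -
  interpret real_distribution std_normal_distribution by (rule real_dist_normal_dist)
  have diff: "ennreal (std_normal_cdf b - std_normal_cdf a)
      = (\<integral>\<^sup>+x. ennreal (std_normal_density x) * indicator {a<..b} x \<partial>lborel)"
    by (simp add: emeasure_Ioc[OF assms(2), symmetric] emeasure_density)
  have const: "ennreal ((b - a) * std_normal_density u)
      = (\<integral>\<^sup>+x. ennreal (std_normal_density u) * indicator {a<..b} x \<partial>lborel)" for u
    using assms by (simp add: nn_integral_cmult ennreal_mult'' mult.commute)
  have "ennreal ((b - a) * std_normal_density b) \<le> ennreal (std_normal_cdf b - std_normal_cdf a)"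
    unfolding diff const using assms
    by (intro nn_integral_mono) (auto simp: indicator_def intro!: ennreal_leI std_normal_density_antimono)
  then show "(b - a) * std_normal_density b \<le> std_normal_cdf b - std_normal_cdf a"
    using cdf_nondecreasing[OF assms(2)] by (simp add: ennreal_le_iff)
  have "ennreal (std_normal_cdf b - std_normal_cdf a) \<le> ennreal ((b - a) * std_normal_density a)"
    unfolding diff const using assms
    by (intro nn_integral_mono) (auto simp: indicator_def intro!: ennreal_leI std_normal_density_antimono)
  then show "std_normal_cdf b - std_normal_cdf a \<le> (b - a) * std_normal_density a"
    using assms(2) by (simp add: ennreal_le_iff)
qed

lemma std_normal_cdf_tail:
  "ennreal (1 - std_normal_cdf t) = (\<integral>\<^sup>+x. ennreal (std_normal_density x) * indicator {t<..} x \<partial>lborel)"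
proof -
  interpret real_distribution std_normal_distribution by (rule real_dist_normal_dist)
  have "1 - std_normal_cdf t = prob {t<..}"
    using prob_compl[of "{..t}"] by (simp add: cdf_def Compl_eq_Diff_UNIV[symmetric])
  then show ?thesis
    by (simp add: emeasure_eq_measure[symmetric] emeasure_density)
qed

text \<open>For \<open>x > t\<close> one has \<open>x^2 >= t^2 + (x - t)^2\<close>, so the density
  is at most \<open>exp (- t^2 / 2)\<close> times the normal density centred at \<open>t\<close>,
  whose total mass is one.\<close>

lemma std_normal_tail_le_exp:
  assumes "0 \<le> t"
  shows "1 - std_normal_cdf t \<le> exp (- t\<^sup>2 / 2)"
proof -
  have le: "std_normal_density x \<le> exp (- (t\<^sup>2 / 2)) * normal_density t 1 x" if "t < x" for x
  proof -
    have "t * (x - t) \<ge> 0" using assms that by simp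
    then have "- x\<^sup>2 / 2 \<le> - t\<^sup>2 / 2 + - (x - t)\<^sup>2 / 2"
      by (simp add: power2_eq_square algebra_simps)
    then have "exp (- x\<^sup>2 / 2) \<le> exp (- t\<^sup>2 / 2) * exp (- (x - t)\<^sup>2 / 2)"
      by (simp only: exp_add[symmetric] exp_le_cancel_iff)
    then show ?thesis
      by (simp add: normal_density_def divide_right_mono)
  qed
  have "ennreal (1 - std_normal_cdf t) \<le> (\<integral>\<^sup>+x. ennreal (exp (- t\<^sup>2 / 2)) * ennreal (normal_density t 1 x) \<partial>lborel)"
    unfolding std_normal_cdf_tail
    by (intro nn_integral_mono) (auto simp: indicator_def ennreal_mult'[symmetric] intro!: ennreal_leI le)
  also have "\<dots> = ennreal (exp (- t\<^sup>2 / 2))"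
    by (simp add: nn_integral_cmult nn_integral_eq_integral)
  finally show ?thesis by (simp add: ennreal_le_iff)
qed

lemma std_normal_singleton: "measure std_normal_distribution {t} = 0"
proof -
  have "emeasure std_normal_distribution {t} = 0"
    by (subst emeasure_density) (auto simp: nn_integral_0_iff_AE intro!: AE_I'[of "{t}"])
  then show ?thesis by (simp add: measure_def)
qed

text \<open>Negation preserves the law, and the absence of atoms lets \<open>{t..}\<close> be traded
  for \<open>{t<..}\<close>.\<close>

lemma std_normal_cdf_minus: "std_normal_cdf (- t) = 1 - std_normal_cdf t"
proof -
  interpret real_distribution std_normal_distribution by (rule real_dist_normal_dist)
  have "distributed std_normal_distribution lborel (\<lambda>x. x) std_normal_density"
    by (simp add: distributed_def distr_id2)
  from normal_density_affine[OF this, of "-1" 0]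
  have D: "distr std_normal_distribution lborel uminus = std_normal_distribution"
    by (simp add: distributed_def)
  have "std_normal_cdf (- t) = measure (distr std_normal_distribution lborel uminus) {..-t}"
    unfolding D by (simp add: cdf_def)
  also have "\<dots> = prob {t..}"
    by (subst measure_distr) (auto intro!: arg_cong[where f=prob])
  also have "\<dots> = prob {t<..}"
  proof -
    have "{t..} = {t} \<union> {t<..}" by auto
    then show ?thesis
      using finite_measure_Union[of "{t}" "{t<..}"] by (simp add: std_normal_singleton)
  qed
  also have "\<dots> = 1 - std_normal_cdf t"
    using prob_compl[of "{..t}"] by (simp add: cdf_def Compl_eq_Diff_UNIV[symmetric])
  finally show ?thesis .
qed

lemma std_normal_cdf_0: "std_normal_cdf 0 = 1 / 2"
  using std_normal_cdf_minus[of 0] by simp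

text \<open>\<open>inv\<close> is a choice function, so a preimage must be exhibited: the
  intermediate value theorem finds one to the right of \<open>0\<close>, where the distribution
  function is \<open>1 / 2\<close>.\<close>

lemma std_normal_cdf_inv:
  assumes "1 / 2 < u" "u < 1"
  shows "std_normal_cdf (inv std_normal_cdf u) = u" "0 < inv std_normal_cdf u"
proof -
  interpret real_distribution std_normal_distribution by (rule real_dist_normal_dist)
  have "eventually (\<lambda>b. u < std_normal_cdf b \<and> 0 < b) at_top"
    by (intro eventually_conj order_tendstoD(1)[OF cdf_lim_at_top_prob assms(2)] eventually_gt_at_top)
  then obtain b where b: "u < std_normal_cdf b" "0 < b"
    using eventually_happens by force
  have "\<exists>t\<ge>0. t \<le> b \<and> std_normal_cdf t = u"
    using assms b by (intro IVT) (auto simp: std_normal_cdf_0 isCont_cdf std_normal_singleton)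
  then show 1: "std_normal_cdf (inv std_normal_cdf u) = u"
    by (auto intro: f_inv_into_f)
  show "0 < inv std_normal_cdf u"
    using cdf_nondecreasing[of "inv std_normal_cdf u" 0] assms 1 std_normal_cdf_0 by force
qed

section \<open>Relative perturbation of the normal tail\<close>

text \<open>A Mills ratio bound: over a step of length \<open>1 / (t + 1)\<close> the density loses
  at most the factor \<open>exp (3 / 2)\<close>, and the tail contains the mass of that step. It
  turns density errors into relative tail errors.\<close>

lemma std_normal_tail_lower:
  assumes "0 \<le> t"
  shows "std_normal_density t \<le> (t + 1) * exp (3 / 2) * (1 - std_normal_cdf t)"
proof -
  interpret real_distribution std_normal_distribution by (rule real_dist_normal_dist)
  define h where "h = 1 / (t + 1)"
  have h: "0 < h" "h \<le> 1" "t * h \<le> 1" using assms by (auto simp: h_def field_simps)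
  have "(t + h)\<^sup>2 / 2 \<le> t\<^sup>2 / 2 + 3 / 2"
    using h mult_mono[of h 1 h 1] by (simp add: power2_eq_square algebra_simps)
  then have "exp (- t\<^sup>2 / 2) \<le> exp (3 / 2) * exp (- (t + h)\<^sup>2 / 2)"
    by (simp add: exp_add[symmetric])
  then have "std_normal_density t \<le> exp (3 / 2) * std_normal_density (t + h)"
    by (simp add: std_normal_density_def divide_right_mono)
  moreover have "h * std_normal_density (t + h) \<le> 1 - std_normal_cdf t"
    using std_normal_cdf_diff_bounds(1)[of t "t + h"] assms h cdf_bounded_prob[of "t + h"] by simp
  then have "std_normal_density (t + h) \<le> (t + 1) * (1 - std_normal_cdf t)"
    using assms by (simp add: h_def field_simps)
  ultimately have "std_normal_density t \<le> exp (3 / 2) * ((t + 1) * (1 - std_normal_cdf t))"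
    by (meson exp_ge_zero mult_left_mono order_trans)
  then show ?thesis by (simp add: mult_ac)
qed

text \<open>The extra mass lies in an interval of length \<open>t * (1 - q)\<close> with
  \<open>q = sqrt (1 - r)\<close>. The density there is at most its value at \<open>t * q\<close>,
  which is \<open>exp (r * t^2 / 2)\<close> times the value at \<open>t\<close>, and the Mills bound
  compares the latter with the tail.\<close>

lemma std_normal_tail_scaled_le:
  assumes "0 \<le> t" "0 \<le> r" "r \<le> 1"
  shows "1 - std_normal_cdf (t * sqrt (1 - r))
    \<le> (1 - std_normal_cdf t) * (1 + r * (t * (t + 1)) * exp (r * t\<^sup>2 / 2 + 3 / 2))"
proof -
  interpret real_distribution std_normal_distribution by (rule real_dist_normal_dist)
  define q where "q = sqrt (1 - r)"
  have q: "0 \<le> q" "q \<le> 1" "1 - q \<le> r" "q\<^sup>2 = 1 - r"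
  proof -
    show "0 \<le> q" "q \<le> 1" "q\<^sup>2 = 1 - r" using assms by (auto simp: q_def)
    then show "1 - q \<le> r" using mult_left_le[of q q] by (simp add: power2_eq_square)
  qed
  have dens: "std_normal_density (t * q) = std_normal_density t * exp (r * t\<^sup>2 / 2)"
  proof -
    have "- (t * q)\<^sup>2 / 2 = - t\<^sup>2 / 2 + r * t\<^sup>2 / 2"
      by (simp add: power_mult_distrib q(4) algebra_simps diff_divide_distrib)
    then show ?thesis by (simp only: std_normal_density_def exp_add mult.assoc)
  qed
  have "1 - std_normal_cdf (t * q) - (1 - std_normal_cdf t) \<le> (t - t * q) * std_normal_density (t * q)"
    using std_normal_cdf_diff_bounds(2)[of "t * q" t] assms q by (simp add: mult_left_le)
  also have "\<dots> = (1 - q) * (t * exp (r * t\<^sup>2 / 2)) * std_normal_density t"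
    unfolding dens by (simp add: algebra_simps)
  also have "\<dots> \<le> r * (t * exp (r * t\<^sup>2 / 2)) * ((t + 1) * exp (3 / 2) * (1 - std_normal_cdf t))"
    using assms q std_normal_tail_lower[OF assms(1)]
    by (intro mult_mono mult_nonneg_nonneg) auto
  also have "\<dots> = (1 - std_normal_cdf t) * (r * (t * (t + 1)) * exp (r * t\<^sup>2 / 2 + 3 / 2))"
    by (simp add: exp_add algebra_simps)
  finally show ?thesis unfolding q_def by (simp add: algebra_simps)
qed

lemma (in prob_space) std_normal_two_sided_tail:
  assumes U: "distributed M lborel U std_normal_density" and "0 \<le> t"
  shows "prob {\<omega> \<in> space M. \<bar>U \<omega>\<bar> > t} \<le> 2 * (1 - std_normal_cdf t)"
proof -
  interpret N: real_distribution std_normal_distribution by (rule real_dist_normal_dist)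
  have [measurable]: "U \<in> borel_measurable M" using U by (auto dest: distributed_measurable)
  have D: "distr M lborel U = std_normal_distribution"
    using U by (simp add: distributed_def)
  have "prob {\<omega> \<in> space M. \<bar>U \<omega>\<bar> > t} = measure (distr M lborel U) {v. \<bar>v\<bar> > t}"
    by (subst measure_distr) (auto intro!: arg_cong[where f=prob])
  also have "\<dots> \<le> measure std_normal_distribution ({..-t} \<union> {t<..})"
    unfolding D by (rule N.finite_measure_mono) auto
  also have "\<dots> \<le> measure std_normal_distribution {..-t} + measure std_normal_distribution {t<..}"
    by (rule measure_Un_le) auto
  also have "\<dots> = 2 * (1 - std_normal_cdf t)"
    using N.prob_compl[of "{..t}"] std_normal_cdf_minus[of t]
    by (simp add: cdf_def Compl_eq_Diff_UNIV[symmetric])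
  finally show ?thesis .
qed

section \<open>Concentration of Gaussian squares\<close>

text \<open>Completing the square leaves a multiple of a centred normal density with variance
  \<open>1 / (1 - 2 * s)\<close>. The logarithm of the multiple is
  \<open>- s - ln (1 - 2 * s) / 2\<close>, controlled by the second-order bound on
  \<open>ln (1 + x)\<close> at \<open>x = - 2 * s\<close>; the restriction to \<open>1 / 4\<close>
  keeps \<open>x\<close> within \<open>1 / 2\<close>.\<close>

lemma std_normal_square_mgf:
  fixes s :: real
  assumes "\<bar>s\<bar> \<le> 1 / 4"
  shows "(\<integral>\<^sup>+x. ennreal (std_normal_density x) * ennreal (exp (s * (x\<^sup>2 - 1))) \<partial>lborel) \<le> ennreal (exp (4 * s\<^sup>2))"
proof -
  define v where "v = 1 / sqrt (1 - 2 * s)"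
  have pos: "1 - 2 * s > 0" using assms by (simp add: abs_le_iff)
  then have v: "v > 0" "v\<^sup>2 = 1 / (1 - 2 * s)" by (auto simp: v_def power_divide)
  have eq: "std_normal_density x * exp (s * (x\<^sup>2 - 1)) = exp (- s) * v * normal_density 0 v x" for x
  proof -
    have "exp (- x\<^sup>2 / 2) * exp (s * (x\<^sup>2 - 1)) = exp (- s) * exp (- x\<^sup>2 / (2 * v\<^sup>2))"
      by (simp add: exp_add[symmetric] v(2)) (simp add: algebra_simps add_divide_distrib diff_divide_distrib)
    moreover have "sqrt (2 * pi * v\<^sup>2) = sqrt (2 * pi) * v"
      using v(1) by (simp only: real_sqrt_mult real_sqrt_abs abs_of_pos)
    ultimately show ?thesis
      using v(1) by (simp add: normal_density_def field_simps)
  qed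
  have "(\<integral>\<^sup>+x. ennreal (std_normal_density x) * ennreal (exp (s * (x\<^sup>2 - 1))) \<partial>lborel)
      = (\<integral>\<^sup>+x. ennreal (exp (- s) * v) * ennreal (normal_density 0 v x) \<partial>lborel)"
    using v(1) by (intro nn_integral_cong) (simp add: ennreal_mult'[symmetric] eq)
  also have "\<dots> = ennreal (exp (- s) * v)"
    using v(1) by (simp add: nn_integral_cmult nn_integral_eq_integral)
  also have "v = exp (- ln (1 - 2 * s) / 2)"
    using pos by (simp add: v_def exp_minus ln_sqrt[symmetric] inverse_eq_divide)
  also have "ennreal (exp (- s) * exp (- ln (1 - 2 * s) / 2)) \<le> ennreal (exp (4 * s\<^sup>2))"
    using abs_ln_one_plus_x_minus_x_bound[of "- 2 * s"] assms
    by (intro ennreal_leI) (simp add: exp_add[symmetric] power2_eq_square abs_le_iff abs_mult)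
  finally show ?thesis .
qed

lemma (in prob_space) std_normal_square_sum_mgf:
  fixes X :: "nat \<Rightarrow> 'a \<Rightarrow> real"
  assumes indep: "indep_vars (\<lambda>_. borel) X {..<n}"
    and normal: "\<And>i. i < n \<Longrightarrow> distributed M lborel (X i) std_normal_density"
    and s: "\<bar>s\<bar> \<le> 1 / 4"
  shows "(\<integral>\<^sup>+\<omega>. ennreal (exp (s * (\<Sum>i<n. (X i \<omega>)\<^sup>2 - 1))) \<partial>M) \<le> ennreal (exp (4 * real n * s\<^sup>2))"
proof -
  have "(\<integral>\<^sup>+\<omega>. ennreal (exp (s * (\<Sum>i<n. (X i \<omega>)\<^sup>2 - 1))) \<partial>M)
      = (\<integral>\<^sup>+\<omega>. (\<Prod>i<n. ennreal (exp (s * ((X i \<omega>)\<^sup>2 - 1)))) \<partial>M)"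
    by (intro nn_integral_cong) (simp add: sum_distrib_left exp_sum prod_ennreal)
  also have "\<dots> = (\<Prod>i<n. \<integral>\<^sup>+\<omega>. ennreal (exp (s * ((X i \<omega>)\<^sup>2 - 1))) \<partial>M)"
    by (intro indep_vars_nn_integral indep_vars_compose2[OF indep]) auto
  also have "\<dots> \<le> (\<Prod>i<n. ennreal (exp (4 * s\<^sup>2)))"
  proof (intro prod_mono_ennreal)
    fix i assume "i \<in> {..<n}"
    then have "(\<integral>\<^sup>+\<omega>. ennreal (exp (s * ((X i \<omega>)\<^sup>2 - 1))) \<partial>M)
        = (\<integral>\<^sup>+x. ennreal (std_normal_density x) * ennreal (exp (s * (x\<^sup>2 - 1))) \<partial>lborel)"
      by (intro distributed_nn_integral[symmetric] normal) auto
    also have "\<dots> \<le> ennreal (exp (4 * s\<^sup>2))" by (rule std_normal_square_mgf[OF s])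
    finally show "(\<integral>\<^sup>+\<omega>. ennreal (exp (s * ((X i \<omega>)\<^sup>2 - 1))) \<partial>M) \<le> ennreal (exp (4 * s\<^sup>2))" .
  qed
  also have "\<dots> = ennreal (exp (4 * real n * s\<^sup>2))"
    by (simp add: prod_ennreal exp_of_nat_mult[symmetric] mult_ac ennreal_power)
  finally show ?thesis .
qed

text \<open>Chernoff's bound for both signs \<open>e\<close> of the centred sum. The exponent
  \<open>4 * n * s^2 - s * n * r\<close> is minimal at \<open>s = r / 8\<close>, with value
  \<open>- n * r^2 / 16\<close>, and \<open>r <= 1\<close> keeps \<open>s\<close> below
  \<open>1 / 4\<close>.\<close>

lemma (in prob_space) std_normal_square_mean_concentration:
  fixes X :: "nat \<Rightarrow> 'a \<Rightarrow> real"
  assumes indep: "indep_vars (\<lambda>_. borel) X {..<n}"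
    and normal: "\<And>i. i < n \<Longrightarrow> distributed M lborel (X i) std_normal_density"
    and n: "n > 0" and r: "0 < r" "r \<le> 1"
  shows "prob {\<omega> \<in> space M. \<bar>emp_mean n (\<lambda>i. (X i \<omega>)\<^sup>2) - 1\<bar> \<ge> r} \<le> 2 * exp (- real n * r\<^sup>2 / 16)"
proof -
  have [measurable]: "X i \<in> borel_measurable M" if "i < n" for i
    using normal[OF that] by (auto dest: distributed_measurable)
  define Y where "Y \<omega> = (\<Sum>i<n. (X i \<omega>)\<^sup>2 - 1)" for \<omega>
  have [measurable]: "Y \<in> borel_measurable M"
    unfolding Y_def by measurable
  have mean: "emp_mean n (\<lambda>i. (X i \<omega>)\<^sup>2) - 1 = Y \<omega> / real n" for \<omega>
    using n by (simp add: emp_mean_def Y_def sum_subtractf field_simps)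
  have one_sided: "prob {\<omega> \<in> space M. e * Y \<omega> \<ge> real n * r} \<le> exp (- real n * r\<^sup>2 / 16)"
    if e: "\<bar>e\<bar> = 1" for e
  proof -
    have "emeasure M {\<omega> \<in> space M. e * Y \<omega> \<ge> real n * r}
        \<le> ennreal (exp (- (r / 8) * (real n * r))) * (\<integral>\<^sup>+\<omega>. ennreal (exp (r / 8 * (e * Y \<omega>))) * indicator (space M) \<omega> \<partial>M)"
      using r by (intro Chernoff_ineq_nn_integral_ge) auto
    also have "(\<integral>\<^sup>+\<omega>. ennreal (exp (r / 8 * (e * Y \<omega>))) * indicator (space M) \<omega> \<partial>M)
        = (\<integral>\<^sup>+\<omega>. ennreal (exp (r / 8 * e * Y \<omega>)) \<partial>M)"
      by (intro nn_integral_cong) (auto simp: mult_ac)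
    also have "\<dots> \<le> ennreal (exp (4 * real n * (r / 8 * e)\<^sup>2))"
      unfolding Y_def using r e
      by (intro std_normal_square_sum_mgf indep normal) (auto simp: abs_mult)
    also have "(r / 8 * e)\<^sup>2 = r\<^sup>2 / 64"
      using e by (auto simp: power_mult_distrib power_divide abs_if split: if_splits)
    also have "ennreal (exp (- (r / 8) * (real n * r))) * ennreal (exp (4 * real n * (r\<^sup>2 / 64)))
        = ennreal (exp (- real n * r\<^sup>2 / 16))"
      by (simp add: ennreal_mult'[symmetric] exp_add[symmetric] power2_eq_square)
    finally show ?thesis
      by (simp add: emeasure_eq_measure ennreal_le_iff mult_left_mono)
  qed
  have "{\<omega> \<in> space M. \<bar>emp_mean n (\<lambda>i. (X i \<omega>)\<^sup>2) - 1\<bar> \<ge> r}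
      = {\<omega> \<in> space M. 1 * Y \<omega> \<ge> real n * r} \<union> {\<omega> \<in> space M. (- 1) * Y \<omega> \<ge> real n * r}"
    unfolding mean using n by (auto simp: abs_if field_simps)
  also have "prob \<dots> \<le> exp (- real n * r\<^sup>2 / 16) + exp (- real n * r\<^sup>2 / 16)"
    by (rule order_trans[OF measure_Un_le add_mono[OF one_sided one_sided]]) auto
  finally show ?thesis by simp
qed

section \<open>The self-normalized score\<close>

lemma linf_norm_le_iff:
  assumes "p > 0"
  shows "linf_norm p d \<le> t \<longleftrightarrow> (\<forall>j<p. \<bar>d j\<bar> \<le> t)"
proof -
  have "{..<p} \<noteq> {}" using assms by auto
  then show ?thesis by (auto simp: linf_norm_def)
qed

lemma abs_le_linf_norm: "j < p \<Longrightarrow> \<bar>d j\<bar> \<le> linf_norm p d"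
  using linf_norm_le_iff[of p d "linf_norm p d"] by auto

lemma linf_norm_nonneg: "p > 0 \<Longrightarrow> 0 \<le> linf_norm p d"
  using abs_le_linf_norm[of 0 p d] by linarith

lemma emp_mean_nonneg: "(\<And>i. i < n \<Longrightarrow> 0 \<le> f i) \<Longrightarrow> 0 \<le> emp_mean n f"
  by (auto simp: emp_mean_def intro!: divide_nonneg_nonneg sum_nonneg)

lemma score_stat_nonneg: "p > 0 \<Longrightarrow> 0 \<le> score_stat n p x \<xi>"
  by (simp add: score_stat_def linf_norm_nonneg emp_mean_nonneg)

text \<open>Lets the error vector be replaced by its restriction to \<open>{..<n}\<close>, the form
  in which it is a point of the product space.\<close>

lemma score_stat_cong:
  assumes "\<And>i. i < n \<Longrightarrow> \<xi> i = \<xi>' i"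
  shows "score_stat n p x \<xi> = score_stat n p x \<xi>'"
  using assms by (simp add: score_stat_def emp_mean_def)

lemma borel_measurable_linf_norm:
  assumes "p > 0" "\<And>j. j < p \<Longrightarrow> (\<lambda>\<omega>. d \<omega> j) \<in> borel_measurable M"
  shows "(\<lambda>\<omega>. linf_norm p (d \<omega>)) \<in> borel_measurable M"
proof (subst borel_measurable_iff_le, intro allI)
  fix a
  have [measurable]: "{\<omega> \<in> space M. \<bar>d \<omega> j\<bar> \<le> a} \<in> sets M" if "j \<in> {..<p}" for j
    using assms(2)[of j] that by (intro borel_measurable_le[of _ M "\<lambda>_. a"]) auto
  have "{\<omega> \<in> space M. linf_norm p (d \<omega>) \<le> a} = (\<Inter>j\<in>{..<p}. {\<omega> \<in> space M. \<bar>d \<omega> j\<bar> \<le> a})"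
    using assms(1) by (auto simp: linf_norm_le_iff)
  also have "\<dots> \<in> sets M"
    using assms(1) by (intro sets.finite_INT) auto
  finally show "{\<omega> \<in> space M. linf_norm p (d \<omega>) \<le> a} \<in> sets M" .
qed

lemma borel_measurable_score_stat:
  assumes "p > 0" "\<And>i. i < n \<Longrightarrow> (\<lambda>\<omega>. \<xi> \<omega> i) \<in> borel_measurable M"
  shows "(\<lambda>\<omega>. score_stat n p x (\<xi> \<omega>)) \<in> borel_measurable M"
proof -
  have [measurable]: "(\<lambda>\<omega>. emp_mean n (\<lambda>i. x i j * \<xi> \<omega> i)) \<in> borel_measurable M"
    "(\<lambda>\<omega>. emp_mean n (\<lambda>i. (\<xi> \<omega> i)\<^sup>2)) \<in> borel_measurable M" for j
    unfolding emp_mean_def using assms(2) by measurable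
  have [measurable]: "(\<lambda>\<omega>. linf_norm p (\<lambda>j. emp_mean n (\<lambda>i. x i j * \<xi> \<omega> i))) \<in> borel_measurable M"
    by (rule borel_measurable_linf_norm[OF assms(1)]) simp
  show ?thesis unfolding score_stat_def by measurable
qed

section \<open>Law and tail of the score under Gaussian errors\<close>

text \<open>Independent normals sum to a normal whose variance is the sum of the squared weights.
  Coordinates of zero weight are discarded first, since a degenerate variable has no normal
  density.\<close>

lemma (in prob_space) std_normal_unit_combination:
  fixes X :: "nat \<Rightarrow> 'a \<Rightarrow> real"
  assumes indep: "indep_vars (\<lambda>_. borel) X {..<n}"
    and normal: "\<And>i. i < n \<Longrightarrow> distributed M lborel (X i) std_normal_density"
    and unit: "(\<Sum>i<n. (w i)\<^sup>2) = 1"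
  shows "distributed M lborel (\<lambda>\<omega>. \<Sum>i<n. w i * X i \<omega>) std_normal_density"
proof -
  define I where "I = {i. i < n \<and> w i \<noteq> 0}"
  have I: "finite I" "I \<subseteq> {..<n}" by (auto simp: I_def)
  have sum: "(\<Sum>i\<in>I. f i) = (\<Sum>i<n. f i)" if "\<And>i. w i = 0 \<Longrightarrow> f i = 0" for f :: "nat \<Rightarrow> real"
    using that by (intro sum.mono_neutral_left) (auto simp: I_def)
  have sq: "(\<Sum>i\<in>I. (w i)\<^sup>2) = 1" using sum[of "\<lambda>i. (w i)\<^sup>2"] unit by simp
  then have "I \<noteq> {}" by auto
  have "distributed M lborel (\<lambda>\<omega>. \<Sum>i\<in>I. w i * X i \<omega>)
      (normal_density (\<Sum>i\<in>I. 0) (sqrt (\<Sum>i\<in>I. \<bar>w i\<bar>\<^sup>2)))"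
  proof (intro sum_indep_normal I \<open>I \<noteq> {}\<close>)
    show "indep_vars (\<lambda>i. borel) (\<lambda>i \<omega>. w i * X i \<omega>) I"
      by (rule indep_vars_compose2[OF indep_vars_subset[OF indep I(2)]]) simp
  next
    fix i assume "i \<in> I"
    then have i: "i < n" "w i \<noteq> 0" by (auto simp: I_def)
    then show "0 < \<bar>w i\<bar>" by simp
    show "distributed M lborel (\<lambda>\<omega>. w i * X i \<omega>) (normal_density 0 \<bar>w i\<bar>)"
      using normal_density_affine[OF normal[OF i(1)], of "w i" 0] i(2) by simp
  qed
  then show ?thesis by (simp add: sq sum)
qed

lemma (in prob_space) normalized_score_std_normal:
  fixes X :: "nat \<Rightarrow> 'a \<Rightarrow> real"
  assumes indep: "indep_vars (\<lambda>_. borel) X {..<n}"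
    and normal: "\<And>i. i < n \<Longrightarrow> distributed M lborel (X i) std_normal_density"
    and design: "emp_mean n (\<lambda>i. (x i j)\<^sup>2) = 1" and n: "n > 0"
  shows "distributed M lborel (\<lambda>\<omega>. sqrt (real n) * emp_mean n (\<lambda>i. x i j * X i \<omega>)) std_normal_density"
proof -
  have "distributed M lborel (\<lambda>\<omega>. \<Sum>i<n. x i j / sqrt (real n) * X i \<omega>) std_normal_density"
    using design n
    by (intro std_normal_unit_combination indep normal)
       (auto simp: emp_mean_def power_divide sum_divide_distrib[symmetric])
  moreover have "(\<Sum>i<n. x i j / sqrt (real n) * X i \<omega>) = sqrt (real n) * emp_mean n (\<lambda>i. x i j * X i \<omega>)" for \<omega>
    using n by (simp add: emp_mean_def sum_divide_distrib[symmetric] field_simps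
        sum_distrib_left[symmetric] flip: real_sqrt_mult)
  ultimately show ?thesis by simp
qed

text \<open>Unless the mean square deviates by \<open>r\<close>, the denominator of the score is at
  least \<open>sqrt (1 - r)\<close>; a large score then forces some standard normal coordinate
  \<open>U j\<close> beyond \<open>t * sqrt (1 - r)\<close> in absolute value. The two terms come
  from the union bound over coordinates and from concentration.\<close>

lemma (in prob_space) score_stat_tail:
  fixes X :: "nat \<Rightarrow> 'a \<Rightarrow> real"
  assumes indep: "indep_vars (\<lambda>_. borel) X {..<n}"
    and normal: "\<And>i. i < n \<Longrightarrow> distributed M lborel (X i) std_normal_density"
    and design: "\<And>j. j < p \<Longrightarrow> emp_mean n (\<lambda>i. (x i j)\<^sup>2) = 1"
    and n: "n > 0" and p: "p > 0" and t: "0 \<le> t" and r: "0 < r" "r < 1"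
  shows "prob {\<omega> \<in> space M. score_stat n p x (\<lambda>i. X i \<omega>) > sqrt (real n) * t}
    \<le> 2 * real p * (1 - std_normal_cdf (t * sqrt (1 - r))) + 2 * exp (- real n * r\<^sup>2 / 16)"
proof -
  define U where "U j \<omega> = sqrt (real n) * emp_mean n (\<lambda>i. x i j * X i \<omega>)" for j \<omega>
  define B where "B j = {\<omega> \<in> space M. \<bar>U j \<omega>\<bar> > t * sqrt (1 - r)}" for j
  define C where "C = {\<omega> \<in> space M. \<bar>emp_mean n (\<lambda>i. (X i \<omega>)\<^sup>2) - 1\<bar> \<ge> r}"
  have [measurable]: "X i \<in> borel_measurable M" if "i < n" for i
    using normal[OF that] by (auto dest: distributed_measurable)
  have U: "distributed M lborel (U j) std_normal_density" if "j < p" for j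
    unfolding U_def[abs_def] using design[OF that] by (intro normalized_score_std_normal indep normal n)
  have [measurable]: "U j \<in> borel_measurable M" for j
    unfolding U_def emp_mean_def by measurable
  have BC: "B j \<in> sets M" "C \<in> sets M" for j
    unfolding B_def C_def emp_mean_def by measurable
  have "{\<omega> \<in> space M. score_stat n p x (\<lambda>i. X i \<omega>) > sqrt (real n) * t} \<subseteq> (\<Union>j<p. B j) \<union> C"
  proof safe
    fix \<omega> assume \<omega>: "\<omega> \<in> space M" "score_stat n p x (\<lambda>i. X i \<omega>) > sqrt (real n) * t" "\<omega> \<notin> C"
    define V where "V = emp_mean n (\<lambda>i. (X i \<omega>)\<^sup>2)"
    have V: "1 - r < V" using \<omega>(1,3) by (auto simp: C_def V_def)
    have sV: "sqrt (1 - r) \<le> sqrt V" "0 < sqrt V" using V r by auto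
    have "sqrt (real n) * t * sqrt V < real n * linf_norm p (\<lambda>j. emp_mean n (\<lambda>i. x i j * X i \<omega>))"
      using \<omega>(2) sV by (simp add: score_stat_def V_def[symmetric] field_simps)
    then have "sqrt (real n) * (t * sqrt V)
        < sqrt (real n) * (sqrt (real n) * linf_norm p (\<lambda>j. emp_mean n (\<lambda>i. x i j * X i \<omega>)))"
      by (simp add: mult.assoc[symmetric])
    then have "t * sqrt V / sqrt (real n) < linf_norm p (\<lambda>j. emp_mean n (\<lambda>i. x i j * X i \<omega>))"
      using n by (simp add: field_simps)
    then obtain j where j: "j < p" "t * sqrt V / sqrt (real n) < \<bar>emp_mean n (\<lambda>i. x i j * X i \<omega>)\<bar>"
      using linf_norm_le_iff[OF p, of _ "t * sqrt V / sqrt (real n)"] by (auto simp: not_le[symmetric])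
    have "t * sqrt (1 - r) \<le> t * sqrt V" using t sV by (intro mult_left_mono) auto
    also have "\<dots> < \<bar>U j \<omega>\<bar>"
      using j(2) n by (simp add: U_def abs_mult field_simps)
    finally have "\<omega> \<in> B j" using \<omega>(1) by (simp add: B_def)
    then show "\<omega> \<in> (\<Union>j<p. B j)" using j(1) by auto
  qed
  then have "prob {\<omega> \<in> space M. score_stat n p x (\<lambda>i. X i \<omega>) > sqrt (real n) * t}
      \<le> prob ((\<Union>j<p. B j) \<union> C)"
    using BC by (intro finite_measure_mono) auto
  also have "\<dots> \<le> prob (\<Union>j<p. B j) + prob C"
    using BC by (intro measure_Un_le) auto
  also have "prob (\<Union>j<p. B j) \<le> (\<Sum>j<p. prob (B j))"
    using BC by (intro finite_measure_subadditive_finite) auto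
  also have "\<dots> \<le> (\<Sum>j<p. 2 * (1 - std_normal_cdf (t * sqrt (1 - r))))"
    unfolding B_def using t r by (intro sum_mono std_normal_two_sided_tail U) auto
  also have "prob C \<le> 2 * exp (- real n * r\<^sup>2 / 16)"
    unfolding C_def using r by (intro std_normal_square_mean_concentration indep normal n) auto
  finally show ?thesis by (simp add: algebra_simps)
qed

text \<open>Independence makes the joint law of the errors the product measure, so the quantile in
  \<open>Lambda_Phi\<close> is a quantile of the score of the errors themselves.\<close>

lemma (in prob_space) distr_score_stat:
  fixes X :: "nat \<Rightarrow> 'a \<Rightarrow> real"
  assumes indep: "indep_vars (\<lambda>_. borel) X {..<n}"
    and normal: "\<And>i. i < n \<Longrightarrow> distributed M lborel (X i) std_normal_density"
    and n: "n > 0" and p: "p > 0"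
  shows "distr (PiM {..<n} (\<lambda>_. std_normal_distribution)) borel (score_stat n p x)
    = distr M borel (\<lambda>\<omega>. score_stat n p x (\<lambda>i. X i \<omega>))"
proof -
  have rv: "X i \<in> borel_measurable M" if "i < n" for i
    using normal[OF that] by (auto dest: distributed_measurable)
  have S: "score_stat n p x \<in> borel_measurable (PiM {..<n} (\<lambda>_. borel))"
    using borel_measurable_score_stat[OF p, of n "\<lambda>\<xi>. \<xi>" "PiM {..<n} (\<lambda>_. borel)"] by simp
  have D: "distr M borel (X i) = std_normal_distribution" if "i < n" for i
  proof -
    have "distr M borel (X i) = distr M lborel (X i)" by (rule distr_cong) auto
    then show ?thesis using normal[OF that] by (simp add: distributed_def)
  qed
  have "distr M (PiM {..<n} (\<lambda>_. borel)) (\<lambda>\<omega>. \<lambda>i\<in>{..<n}. X i \<omega>)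
      = PiM {..<n} (\<lambda>i. distr M borel (X i))"
    using indep_vars_iff_distr_eq_PiM'[of "{..<n}" X "\<lambda>_. borel"] n rv indep by auto
  also have "\<dots> = PiM {..<n} (\<lambda>_. std_normal_distribution)"
    by (intro PiM_cong) (auto simp: D)
  finally have "distr (PiM {..<n} (\<lambda>_. std_normal_distribution)) borel (score_stat n p x)
      = distr M borel (score_stat n p x \<circ> (\<lambda>\<omega>. \<lambda>i\<in>{..<n}. X i \<omega>))"
    using S rv by (subst distr_distr[symmetric]) (auto intro!: measurable_restrict)
  also have "score_stat n p x \<circ> (\<lambda>\<omega>. \<lambda>i\<in>{..<n}. X i \<omega>) = (\<lambda>\<omega>. score_stat n p x (\<lambda>i. X i \<omega>))"
    by (auto simp: fun_eq_iff intro!: score_stat_cong)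
  finally show ?thesis .
qed

section \<open>Quantiles of a distribution function\<close>

lemma (in real_distribution) quantile_le:
  assumes "0 < u" "u \<le> cdf M t"
  shows "quantile M u \<le> t"
proof -
  obtain b where b: "cdf M s < u" if "s \<le> b" for s
    using order_tendstoD(2)[OF cdf_lim_at_bot assms(1)] by (auto simp: eventually_at_bot_linorder)
  then have "bdd_below {t. u \<le> cdf M t}"
    by (intro bdd_belowI[of _ b]) (metis linorder_not_le mem_Collect_eq nle_le)
  then show ?thesis unfolding quantile_def using assms(2) by (intro cInf_lower) auto
qed

text \<open>Every point to the right of the infimum satisfies the defining inequality by
  monotonicity, and right continuity carries it to the infimum itself.\<close>

lemma (in real_distribution) le_cdf_quantile:
  assumes "0 < u" "u < 1"
  shows "u \<le> cdf M (quantile M u)"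
proof -
  obtain b where b: "u < cdf M b"
    using order_tendstoD(1)[OF cdf_lim_at_top_prob assms(2)] eventually_happens by force
  have "u \<le> cdf M t" if less: "quantile M u < t" for t
  proof -
    have ne: "{t. u \<le> cdf M t} \<noteq> {}" using b by (auto intro: less_imp_le)
    obtain s where "u \<le> cdf M s" "s < t"
      using cInf_lessD[OF ne less[unfolded quantile_def]] by auto
    then show ?thesis using cdf_nondecreasing[of s t] by simp
  qed
  then have "eventually (\<lambda>t. u \<le> cdf M t) (at_right (quantile M u))"
    by (simp add: eventually_at_right_less eventually_mono[OF eventually_at_right_less])
  moreover have "(cdf M \<longlongrightarrow> cdf M (quantile M u)) (at_right (quantile M u))"
    using cdf_is_right_cont by (simp add: continuous_within)
  ultimately show ?thesis
    by (intro tendsto_lowerbound[of "cdf M"]) auto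
qed

section \<open>Deterministic error bound\<close>

lemma l1_norm_coord_restrict:
  "l1_norm p (coord_restrict T d) + l1_norm p (coord_restrict (- T) d) = l1_norm p d"
  unfolding l1_norm_def sum.distrib[symmetric]
  by (intro sum.cong) (auto simp: coord_restrict_def)

lemma l1_norm_nonneg: "0 \<le> l1_norm p d"
  by (simp add: l1_norm_def sum_nonneg)

lemma pred_norm_nonneg: "0 \<le> pred_norm n p x d"
  by (simp add: pred_norm_def emp_mean_nonneg)

lemma l2_norm_nonneg: "0 \<le> l2_norm p d"
  by (simp add: l2_norm_def L2_set_nonneg)

lemma pred_norm_zero: "(\<And>j. j < p \<Longrightarrow> d j = 0) \<Longrightarrow> pred_norm n p x d = 0"
  by (simp add: pred_norm_def inner_p_def emp_mean_def)

lemma l2_norm_zero: "(\<And>j. j < p \<Longrightarrow> d j = 0) \<Longrightarrow> l2_norm p d = 0"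
  by (simp add: l2_norm_def L2_set_def)

text \<open>Clearing the denominator stays valid when it is zero: the left side then vanishes and
  the right side is nonnegative.\<close>

lemma re_kappa_le:
  assumes "d \<in> restr_cone p T cbar"
  shows "re_kappa n p x T cbar * l1_norm p (coord_restrict T d) \<le> sqrt (real (card T)) * pred_norm n p x d"
proof -
  have "re_kappa n p x T cbar \<le> sqrt (real (card T)) * pred_norm n p x d / l1_norm p (coord_restrict T d)"
    unfolding re_kappa_def using assms
    by (intro cINF_lower bdd_belowI[of _ 0]) (auto intro!: divide_nonneg_nonneg mult_nonneg_nonneg pred_norm_nonneg l1_norm_nonneg)
  then show ?thesis
    using l1_norm_nonneg[of p "coord_restrict T d"] pred_norm_nonneg[of n p x d]
    by (cases "l1_norm p (coord_restrict T d) = 0") (auto simp: field_simps)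
qed

lemma re_kappa_tilde_le:
  assumes "d \<in> restr_cone p T cbar"
  shows "re_kappa_tilde n p x T cbar * l2_norm p d \<le> pred_norm n p x d"
proof -
  have "re_kappa_tilde n p x T cbar \<le> pred_norm n p x d / l2_norm p d"
    unfolding re_kappa_tilde_def using assms
    by (intro cINF_lower bdd_belowI[of _ 0]) (auto intro!: divide_nonneg_nonneg pred_norm_nonneg l2_norm_nonneg)
  then show ?thesis
    using l2_norm_nonneg[of p d] pred_norm_nonneg[of n p x d]
    by (cases "l2_norm p d = 0") (auto simp: field_simps)
qed

lemma emp_mean_cauchy_schwarz:
  "emp_mean n (\<lambda>i. f i * g i) \<le> sqrt (emp_mean n (\<lambda>i. (f i)\<^sup>2)) * sqrt (emp_mean n (\<lambda>i. (g i)\<^sup>2))"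
proof -
  have "(\<Sum>i<n. f i * g i) \<le> (\<Sum>i<n. \<bar>f i\<bar> * \<bar>g i\<bar>)"
    by (intro sum_mono) (simp add: abs_mult[symmetric])
  also have "\<dots> \<le> L2_set f {..<n} * L2_set g {..<n}"
    by (rule L2_set_mult_ineq)
  finally have "emp_mean n (\<lambda>i. f i * g i) \<le> L2_set f {..<n} * L2_set g {..<n} / real n"
    by (simp add: emp_mean_def divide_right_mono)
  also have "\<dots> = sqrt (emp_mean n (\<lambda>i. (f i)\<^sup>2)) * sqrt (emp_mean n (\<lambda>i. (g i)\<^sup>2))"
    by (simp add: L2_set_def emp_mean_def real_sqrt_divide)
  finally show ?thesis .
qed

text \<open>Exchanging the sums exhibits the left side as a pairing of \<open>d\<close> with the
  score vector, to which Hoelder's inequality between the maximum norm and the sum norm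
  applies.\<close>

lemma score_stat_linear_bound:
  assumes p: "p > 0" and n: "n > 0"
  shows "\<bar>emp_mean n (\<lambda>i. \<xi> i * inner_p p (x i) d)\<bar>
    \<le> sqrt (emp_mean n (\<lambda>i. (\<xi> i)\<^sup>2)) * (score_stat n p x \<xi> / real n) * l1_norm p d"
proof -
  define V where "V = emp_mean n (\<lambda>i. (\<xi> i)\<^sup>2)"
  define L where "L = linf_norm p (\<lambda>j. emp_mean n (\<lambda>i. x i j * \<xi> i))"
  have "emp_mean n (\<lambda>i. \<xi> i * inner_p p (x i) d) = (\<Sum>j<p. d j * emp_mean n (\<lambda>i. x i j * \<xi> i))"
    unfolding emp_mean_def inner_p_def sum_distrib_left sum_divide_distrib
    by (subst sum.swap) (simp add: mult_ac sum_divide_distrib sum_distrib_left)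
  also have "\<bar>\<dots>\<bar> \<le> (\<Sum>j<p. \<bar>d j\<bar> * L)"
    unfolding L_def
    by (rule order_trans[OF sum_abs], rule sum_mono)
       (auto simp: abs_mult intro!: mult_left_mono abs_le_linf_norm[of _ _ "\<lambda>j. emp_mean n (\<lambda>i. x i j * \<xi> i)"])
  also have "\<dots> = L * l1_norm p d"
    by (simp add: l1_norm_def sum_distrib_left mult.commute)
  also have "L = sqrt V * (score_stat n p x \<xi> / real n)"
  proof (cases "V = 0")
    \<comment> \<open>With zero mean square every \<open>\<xi> i\<close> with \<open>i < n\<close>
      vanishes, so the quotient by zero in \<open>score_stat\<close> causes no loss.\<close>
    case True
    then have "(\<Sum>i<n. (\<xi> i)\<^sup>2) = 0" using n by (simp add: V_def emp_mean_def)
    then have "\<xi> i = 0" if "i < n" for i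
      using that by (simp add: sum_nonneg_eq_0_iff)
    then have "emp_mean n (\<lambda>i. x i j * \<xi> i) = 0" for j by (simp add: emp_mean_def)
    moreover have "{..<p} \<noteq> {}" using p by auto
    ultimately show ?thesis using True by (simp add: L_def linf_norm_def)
  next
    case False
    then show ?thesis using n by (simp add: score_stat_def V_def L_def)
  qed
  finally show ?thesis by (simp add: V_def)
qed

text \<open>With \<open>e = q1 - q0\<close>, the identity reads \<open>N\<^sup>2 = 2 * q0 * e + e\<^sup>2 + 2 * G\<close>. The basic inequality and the
  gradient bound confine \<open>e\<close> to a multiple of \<open>\<rho> * N\<close>, so the quadratic term is absorbed on the left.\<close>

lemma lasso_quadratic_bound:
  fixes q0 q1 N G u v l c \<rho> :: real
  assumes nonneg: "0 \<le> q0" "0 \<le> N" "0 \<le> u" "0 \<le> v" "0 < l" "0 \<le> \<rho>" and c: "c > 1"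
    and basic: "q1 - q0 \<le> l * (u - v)"
    and grad: "\<bar>G\<bar> \<le> q0 * (l / c) * (u + v)"
    and expand: "q1\<^sup>2 = q0\<^sup>2 - 2 * G + N\<^sup>2"
    and lower: "- (l / c) * (u + v) \<le> q1 - q0"
    and cone: "v \<le> (c + 1) / (c - 1) * u"
    and eig: "l * u \<le> \<rho> * N"
  shows "(1 - ((c + 1) / (c - 1) * \<rho>)\<^sup>2) * N \<le> 2 * (1 + 1 / c) * q0 * \<rho>"
proof (cases "N = 0")
  case True
  then show ?thesis using nonneg c by simp
next
  case False
  then have N: "N > 0" using nonneg by simp
  define k where "k = (c + 1) / (c - 1)"
  define e where "e = q1 - q0"
  \<comment> \<open>The same multiple \<open>k\<close> serves for both signs of \<open>e\<close>: it
    dominates \<open>1\<close> for the upper bound and \<open>(1 + k) / c\<close> for the lower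
    one.\<close>
  have "(1 + k) / c = 2 / (c - 1)" using c by (simp add: k_def field_simps)
  then have k: "k \<ge> 1" "k \<ge> (1 + k) / c"
    using c by (auto simp: k_def intro: divide_right_mono)
  have "e \<le> l * u" using basic nonneg by (simp add: e_def algebra_simps mult_nonneg_nonneg) (smt (verit) mult_nonneg_nonneg)
  also have "l * u \<le> k * (l * u)" using mult_right_mono[of 1 k "l * u"] k nonneg by simp
  finally have e1: "e \<le> k * (l * u)" .
  have "(l / c) * (u + v) \<le> (l / c) * (u + k * u)"
    using cone nonneg c by (intro mult_left_mono) (auto simp: k_def)
  also have "\<dots> = ((1 + k) / c) * (l * u)" by (simp add: algebra_simps add_divide_distrib)
  also have "\<dots> \<le> k * (l * u)" using k nonneg by (intro mult_right_mono) auto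
  finally have e2: "- (k * (l * u)) \<le> e" using lower by (simp add: e_def)
  have "\<bar>e\<bar> \<le> k * (l * u)" using e1 e2 by simp
  also have "\<dots> \<le> k * (\<rho> * N)" using eig k by (intro mult_left_mono) auto
  finally have "\<bar>e\<bar>\<^sup>2 \<le> (k * (\<rho> * N))\<^sup>2" by (intro power_mono) auto
  then have esq: "e\<^sup>2 \<le> (k * \<rho>)\<^sup>2 * N\<^sup>2" by (simp add: power_mult_distrib mult_ac)
  have "N\<^sup>2 = 2 * q0 * e + e\<^sup>2 + 2 * G"
    using expand by (simp add: e_def power2_eq_square algebra_simps)
  also have "\<dots> \<le> 2 * q0 * (l * (u - v)) + (k * \<rho>)\<^sup>2 * N\<^sup>2 + 2 * (q0 * (l / c) * (u + v))"
    using basic grad esq nonneg by (intro add_mono mult_left_mono) (auto simp: e_def)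
  \<comment> \<open>Collecting terms leaves \<open>v\<close> with a nonpositive coefficient, so only
    \<open>u\<close> has to be bounded by the eigenvalue condition.\<close>
  also have "\<dots> = 2 * q0 * (1 + 1 / c) * (l * u) + (k * \<rho>)\<^sup>2 * N\<^sup>2 - 2 * (1 - 1 / c) * (q0 * l * v)"
    by (simp add: algebra_simps add_divide_distrib diff_divide_distrib)
  also have "\<dots> \<le> 2 * q0 * (1 + 1 / c) * (\<rho> * N) + (k * \<rho>)\<^sup>2 * N\<^sup>2 - 0"
    using eig nonneg c by (intro add_mono diff_mono mult_left_mono mult_nonneg_nonneg) auto
  finally have "((1 - (k * \<rho>)\<^sup>2) * N) * N \<le> (2 * (1 + 1 / c) * q0 * \<rho>) * N"
    by (simp add: algebra_simps power2_eq_square)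
  then show ?thesis using N by (simp add: k_def)
qed

text \<open>The hypotheses of \<open>lasso_quadratic_bound\<close> are verified with
  \<open>q0\<close> and \<open>q1\<close> the root mean squared residuals at \<open>b0\<close> and
  \<open>b\<close>, \<open>u\<close> and \<open>v\<close> the sum norms of the error on and off
  \<open>T\<close>, and \<open>G\<close> the noise paired with the prediction error.\<close>

lemma sqrt_lasso_error_bound:
  fixes c cbar lam \<kappa> \<sigma> :: real
  assumes n: "n > 0" and p: "p > 0" and \<sigma>: "\<sigma> > 0" and \<kappa>: "\<kappa> > 0" and lam: "lam > 0"
    and c: "c > 1" and cbar: "cbar = (c + 1) / (c - 1)"
    and model: "\<And>i. i < n \<Longrightarrow> y i = inner_p p (x i) b0 + \<sigma> * \<epsilon> i"
    and min: "is_sqrt_lasso n p x y lam b"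
    and T: "T = supp p b0"
    and RE: "\<kappa> \<le> re_kappa n p x T cbar" "\<kappa> \<le> re_kappa_tilde n p x T cbar"
    and penalty: "c * score_stat n p x \<epsilon> \<le> lam"
  defines "\<delta> \<equiv> (\<lambda>j. b j - b0 j)"
    and "\<rho> \<equiv> lam * sqrt (real (card T)) / (real n * \<kappa>)"
  shows "\<kappa> * l2_norm p \<delta> \<le> pred_norm n p x \<delta>"
    and "(1 - (cbar * \<rho>)\<^sup>2) * pred_norm n p x \<delta>
      \<le> 2 * (1 + 1 / c) * (\<sigma> * sqrt (emp_mean n (\<lambda>i. (\<epsilon> i)\<^sup>2))) * \<rho>"
proof -
  define V where "V = emp_mean n (\<lambda>i. (\<epsilon> i)\<^sup>2)"
  have V: "0 \<le> V" by (simp add: V_def emp_mean_nonneg)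
  have \<rho>: "0 \<le> \<rho>" using lam \<kappa> by (simp add: \<rho>_def)
  have "\<kappa> * l2_norm p \<delta> \<le> pred_norm n p x \<delta> \<and>
    (1 - (cbar * \<rho>)\<^sup>2) * pred_norm n p x \<delta> \<le> 2 * (1 + 1 / c) * (\<sigma> * sqrt V) * \<rho>"
  proof (cases "\<exists>j<p. \<delta> j \<noteq> 0")
    \<comment> \<open>The zero vector is excluded from the cone, but both claims are trivial for
      it.\<close>
    case False
    then show ?thesis
      using pred_norm_zero[of p \<delta> n x] l2_norm_zero[of p \<delta>] \<sigma> \<rho> c V by simp
  next
    case True
    define l u v G N q0 q1 where "l = lam / real n"
      and "u = l1_norm p (coord_restrict T \<delta>)" and "v = l1_norm p (coord_restrict (- T) \<delta>)"
      and "G = emp_mean n (\<lambda>i. (\<sigma> * \<epsilon> i) * inner_p p (x i) \<delta>)"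
      and "N = pred_norm n p x \<delta>" and "q0 = \<sigma> * sqrt V"
      and "q1 = sqrt (emp_mean n (\<lambda>i. (\<sigma> * \<epsilon> i - inner_p p (x i) \<delta>)\<^sup>2))"
    note defs = l_def u_def v_def G_def N_def q0_def q1_def
    have l: "l > 0" using lam n by (simp add: l_def)
    have uv: "0 \<le> u" "0 \<le> v" "l1_norm p \<delta> = u + v" "0 \<le> N"
      by (simp_all add: defs l1_norm_nonneg pred_norm_nonneg l1_norm_coord_restrict)
    have q: "0 \<le> q0" "0 \<le> q1"
      using \<sigma> V by (auto simp: defs emp_mean_nonneg)
    have scale: "emp_mean n (\<lambda>i. (\<sigma> * \<epsilon> i)\<^sup>2) = \<sigma>\<^sup>2 * V"
      by (simp add: V_def emp_mean_def power_mult_distrib sum_distrib_left)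
    then have q0: "q0 = sqrt (emp_mean n (\<lambda>i. (\<sigma> * \<epsilon> i)\<^sup>2))"
      using \<sigma> by (simp add: q0_def real_sqrt_mult)
    have obj0: "sqrt_lasso_objective n p x y lam b0 = q0 + l * l1_norm p b0"
      using model by (simp add: sqrt_lasso_objective_def q0 l_def emp_mean_def)
    have "y i - inner_p p (x i) b = \<sigma> * \<epsilon> i - inner_p p (x i) \<delta>" if "i < n" for i
      using model[OF that] by (simp add: inner_p_def \<delta>_def algebra_simps sum_subtractf)
    then have obj1: "sqrt_lasso_objective n p x y lam b = q1 + l * l1_norm p b"
      by (simp add: sqrt_lasso_objective_def q1_def l_def emp_mean_def)
    \<comment> \<open>Off \<open>T\<close> the true coefficient is zero, so the coordinate of
      \<open>b\<close> is the error itself; on \<open>T\<close> the triangle inequality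
      applies.\<close>
    have "l1_norm p b0 - l1_norm p b \<le> u - v"
      unfolding l1_norm_def u_def v_def sum_subtractf[symmetric]
      by (intro sum_mono) (auto simp: coord_restrict_def \<delta>_def T supp_def)
    then have "l * (l1_norm p b0 - l1_norm p b) \<le> l * (u - v)"
      using l by (intro mult_left_mono) auto
    moreover have "q1 + l * l1_norm p b \<le> q0 + l * l1_norm p b0"
      using min unfolding is_sqrt_lasso_def is_arg_min_linorder by (metis obj0 obj1)
    ultimately have basic: "q1 - q0 \<le> l * (u - v)" by (simp add: algebra_simps)
    have "G = \<sigma> * emp_mean n (\<lambda>i. \<epsilon> i * inner_p p (x i) \<delta>)"
      by (simp add: G_def emp_mean_def sum_distrib_left mult_ac)
    then have "\<bar>G\<bar> = \<sigma> * \<bar>emp_mean n (\<lambda>i. \<epsilon> i * inner_p p (x i) \<delta>)\<bar>"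
      using \<sigma> by (simp add: abs_mult)
    also have "\<dots> \<le> \<sigma> * (sqrt V * (score_stat n p x \<epsilon> / real n) * l1_norm p \<delta>)"
      unfolding V_def using \<sigma> by (intro mult_left_mono score_stat_linear_bound p n) auto
    also have "\<dots> \<le> \<sigma> * (sqrt V * (l / c) * l1_norm p \<delta>)"
    proof -
      have "score_stat n p x \<epsilon> / real n \<le> l / c"
        using penalty c n by (simp add: l_def field_simps)
      then show ?thesis using \<sigma> V l1_norm_nonneg by (intro mult_left_mono mult_right_mono) auto
    qed
    finally have grad: "\<bar>G\<bar> \<le> q0 * (l / c) * (u + v)"
      by (simp add: q0_def uv mult_ac)
    have expand: "q1\<^sup>2 = q0\<^sup>2 - 2 * G + N\<^sup>2"
      unfolding q1_def q0 N_def pred_norm_def G_def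
      by (simp add: emp_mean_nonneg)
         (simp add: emp_mean_def power2_diff sum.distrib sum_subtractf sum_distrib_left add_divide_distrib diff_divide_distrib mult_ac)
    \<comment> \<open>The subgradient inequality for the root mean square: Cauchy-Schwarz between
      the residuals at \<open>b0\<close> and \<open>b\<close> gives
      \<open>q0^2 - G <= q0 * q1\<close>, and \<open>grad\<close> allows division by
      \<open>q0\<close>. For \<open>q0 = 0\<close> nonnegativity of \<open>q1\<close>
      suffices.\<close>
    have lower: "- (l / c) * (u + v) \<le> q1 - q0"
    proof (cases "q0 = 0")
      case True
      moreover have "0 \<le> (l / c) * (u + v)" using l c uv by simp
      ultimately show ?thesis using q by simp
    next
      case False
      have "emp_mean n (\<lambda>i. (\<sigma> * \<epsilon> i) * (\<sigma> * \<epsilon> i - inner_p p (x i) \<delta>)) = q0\<^sup>2 - G"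
        unfolding q0 G_def
        by (simp add: emp_mean_nonneg)
           (simp add: emp_mean_def power2_eq_square sum_subtractf diff_divide_distrib algebra_simps)
      then have "q0\<^sup>2 - G \<le> q0 * q1"
        using emp_mean_cauchy_schwarz[of n "\<lambda>i. \<sigma> * \<epsilon> i" "\<lambda>i. \<sigma> * \<epsilon> i - inner_p p (x i) \<delta>"]
        by (simp add: q0 q1_def)
      then have "q0 * (q0 - q1) \<le> q0 * ((l / c) * (u + v))"
        using grad by (simp add: power2_eq_square algebra_simps)
      then have "q0 - q1 \<le> (l / c) * (u + v)"
        by (rule mult_left_le_imp_le) (use False q in simp)
      then show ?thesis by simp
    qed
    \<comment> \<open>Chaining \<open>basic\<close> with \<open>lower\<close> eliminates the
      residuals; solving for \<open>v\<close> produces the constant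
      \<open>(c + 1) / (c - 1)\<close>.\<close>
    have "(u + v) / c \<ge> v - u"
    proof -
      have "l * (v - u) \<le> l * ((u + v) / c)" using basic lower by (simp add: algebra_simps)
      then show ?thesis by (rule mult_left_le_imp_le) (rule l)
    qed
    then have cone: "v \<le> (c + 1) / (c - 1) * u"
      using c by (simp add: field_simps)
    then have mem: "\<delta> \<in> restr_cone p T cbar"
      using True by (simp add: restr_cone_def cbar u_def v_def)
    have "\<kappa> * u \<le> sqrt (real (card T)) * N"
      using re_kappa_le[OF mem, of n x] mult_right_mono[OF RE(1) uv(1)] by (simp add: u_def N_def)
    then have "l * (\<kappa> * u) \<le> l * (sqrt (real (card T)) * N)" using l by (intro mult_left_mono) auto
    then have eig: "l * u \<le> \<rho> * N"
      using \<kappa> n by (simp add: \<rho>_def l_def field_simps)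
    have "\<kappa> * l2_norm p \<delta> \<le> N"
      using re_kappa_tilde_le[OF mem, of n x] mult_right_mono[OF RE(2) l2_norm_nonneg[of p \<delta>]] by (simp add: N_def)
    then show ?thesis
      using lasso_quadratic_bound[OF q(1) uv(4) uv(1,2) l \<rho> c basic grad expand lower cone eig]
      by (simp add: cbar N_def q0_def)
  qed
  then show "\<kappa> * l2_norm p \<delta> \<le> pred_norm n p x \<delta>"
    and "(1 - (cbar * \<rho>)\<^sup>2) * pred_norm n p x \<delta>
      \<le> 2 * (1 + 1 / c) * (\<sigma> * sqrt (emp_mean n (\<lambda>i. (\<epsilon> i)\<^sup>2))) * \<rho>"
    by (auto simp: V_def)
qed

section \<open>Penalty levels and asymptotics\<close>

text \<open>The good event excludes two failures: a score above \<open>lam / c\<close>, and a mean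
  square off by \<open>r\<close>. On it the deterministic bound applies with noise level at most
  \<open>\<sigma> * sqrt (1 + r)\<close>. The event is built from the errors alone, hence measurable
  whichever minimizer \<open>b\<close> picks.\<close>

lemma (in prob_space) sqrt_lasso_error_probability:
  fixes c cbar lam \<kappa> \<sigma> :: real and y \<epsilon> :: "nat \<Rightarrow> 'a \<Rightarrow> real"
  assumes n: "n > 0" and p: "p > 0" and \<sigma>: "\<sigma> > 0" and \<kappa>: "\<kappa> > 0" and lam: "lam > 0"
    and c: "c > 1" and cbar: "cbar = (c + 1) / (c - 1)"
    and indep: "indep_vars (\<lambda>_. borel) \<epsilon> {..<n}"
    and normal: "\<And>i. i < n \<Longrightarrow> distributed M lborel (\<epsilon> i) std_normal_density"
    and model: "\<And>i \<omega>. i < n \<Longrightarrow> \<omega> \<in> space M \<Longrightarrow> y i \<omega> = inner_p p (x i) b0 + \<sigma> * \<epsilon> i \<omega>"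
    and min: "\<And>\<omega>. \<omega> \<in> space M \<Longrightarrow> is_sqrt_lasso n p x (\<lambda>i. y i \<omega>) lam (b \<omega>)"
    and RE: "\<kappa> \<le> re_kappa n p x (supp p b0) cbar" "\<kappa> \<le> re_kappa_tilde n p x (supp p b0) cbar"
    and penalty: "prob {\<omega> \<in> space M. score_stat n p x (\<lambda>i. \<epsilon> i \<omega>) > lam / c} \<le> \<eta>"
    and r: "0 < r" "r \<le> 1"
  defines "\<rho> \<equiv> lam * sqrt (real (card (supp p b0))) / (real n * \<kappa>)"
  obtains A where "A \<in> sets M" "1 - \<eta> - 2 * exp (- real n * r\<^sup>2 / 16) \<le> prob A"
    "\<And>\<omega>. \<omega> \<in> A \<Longrightarrow> \<kappa> * l2_norm p (\<lambda>j. b \<omega> j - b0 j) \<le> pred_norm n p x (\<lambda>j. b \<omega> j - b0 j)"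
    "\<And>\<omega>. \<omega> \<in> A \<Longrightarrow> (1 - (cbar * \<rho>)\<^sup>2) * pred_norm n p x (\<lambda>j. b \<omega> j - b0 j)
      \<le> 2 * (1 + 1 / c) * (\<sigma> * sqrt (1 + r)) * \<rho>"
proof -
  have rv: "\<epsilon> i \<in> borel_measurable M" if "i < n" for i
    using normal[OF that] by (auto dest: distributed_measurable)
  have [measurable]: "(\<lambda>\<omega>. score_stat n p x (\<lambda>i. \<epsilon> i \<omega>)) \<in> borel_measurable M"
    by (intro borel_measurable_score_stat p rv)
  have [measurable]: "(\<lambda>\<omega>. emp_mean n (\<lambda>i. (\<epsilon> i \<omega>)\<^sup>2)) \<in> borel_measurable M"
    unfolding emp_mean_def using rv by measurable
  define B where "B = {\<omega> \<in> space M. score_stat n p x (\<lambda>i. \<epsilon> i \<omega>) > lam / c}"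
  define C where "C = {\<omega> \<in> space M. \<bar>emp_mean n (\<lambda>i. (\<epsilon> i \<omega>)\<^sup>2) - 1\<bar> \<ge> r}"
  have BC: "B \<in> sets M" "C \<in> sets M" by (simp_all add: B_def C_def)
  have "prob C \<le> 2 * exp (- real n * r\<^sup>2 / 16)"
    unfolding C_def by (intro std_normal_square_mean_concentration indep normal n r)
  moreover have "prob (B \<union> C) \<le> prob B + prob C"
    using BC by (intro measure_Un_le) auto
  ultimately have "1 - \<eta> - 2 * exp (- real n * r\<^sup>2 / 16) \<le> prob (space M - (B \<union> C))"
    using penalty BC by (subst prob_compl) (auto simp: B_def)
  moreover have "\<kappa> * l2_norm p (\<lambda>j. b \<omega> j - b0 j) \<le> pred_norm n p x (\<lambda>j. b \<omega> j - b0 j) \<and>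
    (1 - (cbar * \<rho>)\<^sup>2) * pred_norm n p x (\<lambda>j. b \<omega> j - b0 j) \<le> 2 * (1 + 1 / c) * (\<sigma> * sqrt (1 + r)) * \<rho>"
    if \<omega>: "\<omega> \<in> space M - (B \<union> C)" for \<omega>
  proof -
    have pen: "c * score_stat n p x (\<lambda>i. \<epsilon> i \<omega>) \<le> lam"
      using \<omega> c by (auto simp: B_def field_simps)
    have "sqrt (emp_mean n (\<lambda>i. (\<epsilon> i \<omega>)\<^sup>2)) \<le> sqrt (1 + r)"
      using \<omega> by (auto simp: C_def)
    moreover have "0 \<le> \<rho>" using lam \<kappa> by (simp add: \<rho>_def)
    ultimately have "2 * (1 + 1 / c) * (\<sigma> * sqrt (emp_mean n (\<lambda>i. (\<epsilon> i \<omega>)\<^sup>2))) * \<rho>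
        \<le> 2 * (1 + 1 / c) * (\<sigma> * sqrt (1 + r)) * \<rho>"
      using c \<sigma> by (intro mult_right_mono mult_left_mono) auto
    moreover note sqrt_lasso_error_bound[OF n p \<sigma> \<kappa> lam c cbar _ min refl RE pen, folded \<rho>_def]
    ultimately show ?thesis using \<omega> model by force
  qed
  ultimately show ?thesis using BC by (intro that[of "space M - (B \<union> C)"]) auto
qed

text \<open>As \<open>\<alpha> < 1\<close> and \<open>p >= 1\<close>, the level lies strictly
  between \<open>1 / 2\<close> and \<open>1\<close>, where \<open>inv\<close> yields a true
  quantile; the last bound is the exponential tail bound after taking logarithms.\<close>

lemma normal_quantile_penalty:
  fixes \<alpha> :: real
  assumes p: "p > 0" and \<alpha>: "0 < \<alpha>" "\<alpha> < 1"
  defines "t \<equiv> inv std_normal_cdf (1 - \<alpha> / (2 * real p))"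
  shows "0 < t" "2 * real p * (1 - std_normal_cdf t) = \<alpha>" "t\<^sup>2 \<le> 2 * ln (2 * real p / \<alpha>)"
proof -
  have "\<alpha> / (2 * real p) < 1 / 2" "0 < \<alpha> / (2 * real p)"
    using p \<alpha> by (auto simp: field_simps)
  then have t: "std_normal_cdf t = 1 - \<alpha> / (2 * real p)" "0 < t"
    unfolding t_def by (intro std_normal_cdf_inv; simp)+
  then show "0 < t" "2 * real p * (1 - std_normal_cdf t) = \<alpha>" using p by auto
  have "\<alpha> / (2 * real p) \<le> exp (- t\<^sup>2 / 2)"
    using std_normal_tail_le_exp[of t] t by simp
  then have "ln (\<alpha> / (2 * real p)) \<le> ln (exp (- t\<^sup>2 / 2))"
    using p \<alpha> by (subst ln_le_cancel_iff) auto
  moreover have "ln (\<alpha> / (2 * real p)) = - ln (2 * real p / \<alpha>)"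
    using p \<alpha> by (simp add: ln_div)
  ultimately show "t\<^sup>2 \<le> 2 * ln (2 * real p / \<alpha>)" by simp
qed

text \<open>At this \<open>t\<close> the union bound over two-sided tails equals
  \<open>\<alpha>\<close> exactly. The factor multiplying \<open>\<alpha>\<close> is the price of
  the random denominator, with powers of \<open>t\<close> bounded through \<open>w\<close>.\<close>

lemma (in prob_space) score_stat_tail_normal_quantile:
  fixes X :: "nat \<Rightarrow> 'a \<Rightarrow> real" and \<alpha> :: real
  assumes indep: "indep_vars (\<lambda>_. borel) X {..<n}"
    and normal: "\<And>i. i < n \<Longrightarrow> distributed M lborel (X i) std_normal_density"
    and design: "\<And>j. j < p \<Longrightarrow> emp_mean n (\<lambda>i. (x i j)\<^sup>2) = 1"
    and n: "n > 0" and p: "p > 0" and \<alpha>: "0 < \<alpha>" "\<alpha> < 1" and r: "0 < r" "r < 1"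
  defines "t \<equiv> inv std_normal_cdf (1 - \<alpha> / (2 * real p))"
    and "w \<equiv> 2 * ln (2 * real p / \<alpha>)"
  shows "prob {\<omega> \<in> space M. score_stat n p x (\<lambda>i. X i \<omega>) > sqrt (real n) * t}
    \<le> \<alpha> * (1 + r * (2 * w + 1) * exp (r * w / 2 + 3 / 2)) + 2 * exp (- real n * r\<^sup>2 / 16)"
proof -
  note t = normal_quantile_penalty[OF p \<alpha>, folded t_def w_def]
  have w: "0 \<le> w" using order_trans[OF zero_le_power2 t(3)] .
  \<comment> \<open>By \<open>(t - 1)^2 >= 0\<close> the linear term is at most
    \<open>(t^2 + 1) / 2\<close>.\<close>
  have tt: "t * (t + 1) \<le> 2 * w + 1"
    using t(3) zero_le_power2[of "t - 1"] zero_le_power2[of t]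
    unfolding power2_eq_square left_diff_distrib right_diff_distrib distrib_left by linarith
  have "2 * real p * (1 - std_normal_cdf (t * sqrt (1 - r)))
      \<le> 2 * real p * ((1 - std_normal_cdf t) * (1 + r * (t * (t + 1)) * exp (r * t\<^sup>2 / 2 + 3 / 2)))"
    using t r by (intro mult_left_mono std_normal_tail_scaled_le) auto
  also have "\<dots> = \<alpha> * (1 + r * (t * (t + 1)) * exp (r * t\<^sup>2 / 2 + 3 / 2))"
    using t(2) by (simp only: mult.assoc[symmetric])
  also have "\<dots> \<le> \<alpha> * (1 + r * (2 * w + 1) * exp (r * w / 2 + 3 / 2))"
    using tt t r w \<alpha>
    by (intro mult_left_mono add_left_mono mult_mono exp_le_cancel_iff[THEN iffD2] add_right_mono divide_right_mono)
       auto
  finally show ?thesis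
    using score_stat_tail[where x=x, OF indep normal design n p less_imp_le[OF t(1)] r] by linarith
qed

text \<open>A vanishing score forces its first coordinate to vanish, and that coordinate is normal,
  hence without atoms. This serves to show that the exact penalty is positive.\<close>

lemma (in prob_space) prob_score_stat_nonpos:
  fixes X :: "nat \<Rightarrow> 'a \<Rightarrow> real"
  assumes indep: "indep_vars (\<lambda>_. borel) X {..<n}"
    and normal: "\<And>i. i < n \<Longrightarrow> distributed M lborel (X i) std_normal_density"
    and design: "\<And>j. j < p \<Longrightarrow> emp_mean n (\<lambda>i. (x i j)\<^sup>2) = 1"
    and n: "n > 0" and p: "p > 0"
  shows "prob {\<omega> \<in> space M. score_stat n p x (\<lambda>i. X i \<omega>) \<le> 0} = 0"
proof -
  define U where "U \<omega> = sqrt (real n) * emp_mean n (\<lambda>i. x i 0 * X i \<omega>)" for \<omega>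
  have [measurable]: "X i \<in> borel_measurable M" if "i < n" for i
    using normal[OF that] by (auto dest: distributed_measurable)
  have U: "distributed M lborel U std_normal_density"
    unfolding U_def[abs_def] by (intro normalized_score_std_normal indep normal n design p)
  have [measurable]: "U \<in> borel_measurable M" unfolding U_def emp_mean_def by measurable
  have D: "distr M lborel U = std_normal_distribution" using U by (simp add: distributed_def)
  have "{\<omega> \<in> space M. score_stat n p x (\<lambda>i. X i \<omega>) \<le> 0} \<subseteq> {\<omega> \<in> space M. U \<omega> = 0}"
  proof safe
    fix \<omega> assume "score_stat n p x (\<lambda>i. X i \<omega>) \<le> 0"
    then have "score_stat n p x (\<lambda>i. X i \<omega>) = 0"
      using score_stat_nonneg[OF p] by (simp add: antisym)
    \<comment> \<open>Pairing with the first unit vector brings in the linear bound, which already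
      covers a zero denominator.\<close>
    then have "emp_mean n (\<lambda>i. X i \<omega> * inner_p p (x i) (\<lambda>j. if j = 0 then 1 else 0)) = 0"
      using score_stat_linear_bound[OF p n, of "\<lambda>i. X i \<omega>" x "\<lambda>j. if j = 0 then 1 else 0"] by simp
    moreover have "inner_p p (x i) (\<lambda>j. if j = 0 then 1 else 0) = x i 0" for i
      using p by (simp add: inner_p_def if_distrib cong: if_cong)
    ultimately show "U \<omega> = 0"
      by (simp add: U_def mult.commute)
  qed
  then have "prob {\<omega> \<in> space M. score_stat n p x (\<lambda>i. X i \<omega>) \<le> 0} \<le> prob {\<omega> \<in> space M. U \<omega> = 0}"
    by (intro finite_measure_mono) auto
  also have "\<dots> = measure (distr M lborel U) {0}"
    by (subst measure_distr) (auto intro!: arg_cong[where f=prob])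
  also have "\<dots> = 0" unfolding D by (rule std_normal_singleton)
  finally show ?thesis by (simp add: measure_le_0_iff)
qed

text \<open>The distribution function of the score vanishes at \<open>0\<close> and reaches
  \<open>1 - \<alpha>\<close> at its quantile, which gives the first two claims. For the third, any
  point exceeded with probability at most \<open>\<alpha>\<close> bounds the quantile; half of
  \<open>\<alpha>\<close> is spent on the union bound and half on concentration.\<close>

lemma (in prob_space) exact_penalty:
  fixes X :: "nat \<Rightarrow> 'a \<Rightarrow> real" and \<alpha> :: real
  assumes indep: "indep_vars (\<lambda>_. borel) X {..<n}"
    and normal: "\<And>i. i < n \<Longrightarrow> distributed M lborel (X i) std_normal_density"
    and design: "\<And>j. j < p \<Longrightarrow> emp_mean n (\<lambda>i. (x i j)\<^sup>2) = 1"
    and n: "n > 0" and p: "p > 0" and \<alpha>: "0 < \<alpha>" "\<alpha> < 1"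
  defines "\<Lambda> \<equiv> Lambda_Phi n p x (1 - \<alpha>)"
  shows "0 < \<Lambda>"
    and "prob {\<omega> \<in> space M. score_stat n p x (\<lambda>i. X i \<omega>) > \<Lambda>} \<le> \<alpha>"
    and "\<And>r. 0 < r \<Longrightarrow> r < 1 \<Longrightarrow> 2 * exp (- real n * r\<^sup>2 / 16) \<le> \<alpha> / 2 \<Longrightarrow>
      \<Lambda> \<le> sqrt (real n) * sqrt (2 * ln (4 * real p / \<alpha>) / (1 - r))"
proof -
  define S where "S \<omega> = score_stat n p x (\<lambda>i. X i \<omega>)" for \<omega>
  have rv: "X i \<in> borel_measurable M" if "i < n" for i
    using normal[OF that] by (auto dest: distributed_measurable)
  have S [measurable]: "S \<in> borel_measurable M"
    unfolding S_def[abs_def] by (intro borel_measurable_score_stat p rv)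
  interpret N: real_distribution "distr M borel S" by (rule real_distribution_distr[OF S])
  have \<Lambda>: "\<Lambda> = quantile (distr M borel S) (1 - \<alpha>)"
    by (simp add: \<Lambda>_def Lambda_Phi_def distr_score_stat[OF indep normal n p] S_def[abs_def])
  have cdf: "cdf (distr M borel S) t = prob {\<omega> \<in> space M. S \<omega> \<le> t}" for t
    by (simp add: cdf_def measure_distr) (auto intro!: arg_cong[where f=prob])
  have tail: "prob {\<omega> \<in> space M. t < S \<omega>} = 1 - cdf (distr M borel S) t" for t
  proof -
    have "{\<omega> \<in> space M. t < S \<omega>} = space M - {\<omega> \<in> space M. S \<omega> \<le> t}" by auto
    then show ?thesis by (simp add: prob_compl cdf)
  qed
  have q: "1 - \<alpha> \<le> cdf (distr M borel S) \<Lambda>"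
    unfolding \<Lambda> using \<alpha> by (intro N.le_cdf_quantile) auto
  show "prob {\<omega> \<in> space M. score_stat n p x (\<lambda>i. X i \<omega>) > \<Lambda>} \<le> \<alpha>"
    using q tail[of \<Lambda>] by (simp add: S_def)
  show "0 < \<Lambda>"
  proof (rule ccontr)
    assume "\<not> 0 < \<Lambda>"
    then have "cdf (distr M borel S) \<Lambda> \<le> cdf (distr M borel S) 0"
      by (intro N.cdf_nondecreasing) auto
    also have "\<dots> = 0"
      unfolding cdf S_def by (rule prob_score_stat_nonpos[OF indep normal design n p])
    finally show False using q \<alpha> by simp
  qed
  fix r :: real assume r: "0 < r" "r < 1" "2 * exp (- real n * r\<^sup>2 / 16) \<le> \<alpha> / 2"
  \<comment> \<open>Taking \<open>4 * p\<close> instead of \<open>2 * p\<close> leaves the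
    coordinates a total of \<open>\<alpha> / 2\<close>; the division by \<open>1 - r\<close> in
    \<open>t\<close> cancels the shrinkage of the threshold in
    \<open>score_stat_tail\<close>.\<close>
  define w where "w = ln (4 * real p / \<alpha>)"
  have w: "0 \<le> w" "exp (- w) = \<alpha> / (4 * real p)"
    using p \<alpha> by (auto simp: w_def exp_minus inverse_eq_divide)
  define t where "t = sqrt (2 * w / (1 - r))"
  have t: "0 \<le> t" "t * sqrt (1 - r) = sqrt (2 * w)"
    using w r by (auto simp: t_def simp flip: real_sqrt_mult)
  have "1 - std_normal_cdf (t * sqrt (1 - r)) \<le> \<alpha> / (4 * real p)"
    using std_normal_tail_le_exp[of "sqrt (2 * w)"] w t by simp
  then have "2 * real p * (1 - std_normal_cdf (t * sqrt (1 - r))) \<le> 2 * real p * (\<alpha> / (4 * real p))"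
    by (intro mult_left_mono) auto
  also have "\<dots> = \<alpha> / 2" using p by simp
  finally have "prob {\<omega> \<in> space M. sqrt (real n) * t < S \<omega>} \<le> \<alpha>"
    using score_stat_tail[where x=x, OF indep normal design n p t(1) r(1,2)] r(3) by (simp add: S_def)
  then have "1 - \<alpha> \<le> cdf (distr M borel S) (sqrt (real n) * t)" by (simp add: tail)
  then have "\<Lambda> \<le> sqrt (real n) * t"
    unfolding \<Lambda> using \<alpha> by (intro N.quantile_le) auto
  then show "\<Lambda> \<le> sqrt (real n) * sqrt (2 * ln (4 * real p / \<alpha>) / (1 - r))"
    by (simp add: t_def w_def)
qed

section \<open>Limits along the sequence of models\<close>

text \<open>The radius \<open>r\<close> balances two demands: \<open>exp (- n * r\<^sup>2 / 16)\<close> must be negligible against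
  \<open>\<alpha>\<close>, while \<open>r * ln (p / \<alpha>)\<close> must vanish. With \<open>g = ln (p / \<alpha>)\<^sup>2 * ln (1 / \<alpha>) / n\<close>, inflating
  \<open>16 * ln (1 / \<alpha>) / n\<close> by \<open>1 + 1 / sqrt g\<close> gives both.\<close>

lemma concentration_radius:
  fixes p :: "nat \<Rightarrow> nat" and \<alpha> :: "nat \<Rightarrow> real"
  assumes level: "eventually (\<lambda>n. 0 < \<alpha> n \<and> \<alpha> n \<le> a) sequentially" "0 < a" "a < 1"
    and G: "(\<lambda>n. (ln (real (p n) / \<alpha> n))\<^sup>2 * ln (1 / \<alpha> n)) \<in> o(\<lambda>n. real n)"
      "filterlim (\<lambda>n. real (p n) / \<alpha> n) at_top sequentially"
  obtains r where "eventually (\<lambda>n. 0 < r n \<and> r n < 1) sequentially" "r \<longlonglongrightarrow> 0"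
    "(\<lambda>n. r n * ln (real (p n) / \<alpha> n)) \<longlonglongrightarrow> 0"
    "(\<lambda>n. 2 * exp (- real n * (r n)\<^sup>2 / 16) / \<alpha> n) \<longlonglongrightarrow> 0"
proof -
  define l L g where "l n = ln (1 / \<alpha> n)" and "L n = ln (real (p n) / \<alpha> n)"
    and "g n = (L n)\<^sup>2 * l n / real n" for n
  define r where "r n = sqrt (16 * l n * (1 + 1 / sqrt (g n)) / real n)" for n
  \<comment> \<open>A level bounded away from one keeps \<open>l\<close> above a positive constant,
    so that \<open>g\<close> is eventually positive.\<close>
  define l0 where "l0 = ln (1 / a)"
  have l0: "l0 > 0" using level by (simp add: l0_def)
  have g0: "g \<longlonglongrightarrow> 0"
    using smalloD_tendsto[OF G(1)] by (simp add: g_def[abs_def] L_def l_def)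
  have "filterlim L at_top sequentially"
    unfolding L_def[abs_def] by (rule filterlim_compose[OF ln_at_top G(2)])
  then have "eventually (\<lambda>n. L n \<ge> 1) sequentially"
    by (simp add: filterlim_at_top)
  with level(1) eventually_gt_at_top[of 0]
  have ev: "eventually (\<lambda>n. 0 < \<alpha> n \<and> l n \<ge> l0 \<and> L n \<ge> 1 \<and> n > 0 \<and> g n > 0) sequentially"
  proof eventually_elim
    case (elim n)
    then have "l n \<ge> l0" using level by (auto simp: l_def l0_def ln_div)
    moreover from this have "g n > 0" using elim l0 by (auto simp: g_def intro!: divide_pos_pos mult_pos_pos)
    ultimately show ?case using elim by auto
  qed
  have rL: "(\<lambda>n. r n * L n) \<longlonglongrightarrow> 0"
  proof (rule Lim_transform_eventually)
    show "(\<lambda>n. sqrt (16 * (g n + sqrt (g n)))) \<longlonglongrightarrow> 0"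
      using g0 by (auto intro!: tendsto_eq_intros)
    show "eventually (\<lambda>n. sqrt (16 * (g n + sqrt (g n))) = r n * L n) sequentially"
      using ev
    proof eventually_elim
      case (elim n)
      have "r n * L n = sqrt (16 * l n * (1 + 1 / sqrt (g n)) / real n * (L n)\<^sup>2)"
        using elim by (subst real_sqrt_mult) (simp add: r_def)
      also have "16 * l n * (1 + 1 / sqrt (g n)) / real n * (L n)\<^sup>2 = 16 * (g n * (1 + 1 / sqrt (g n)))"
        by (simp add: g_def)
      also have "g n * (1 + 1 / sqrt (g n)) = g n + sqrt (g n)"
        using elim by (simp add: distrib_left real_div_sqrt)
      finally show ?case by simp
    qed
  qed
  have rpos: "eventually (\<lambda>n. 0 < r n) sequentially"
    using ev
  proof eventually_elim
    case (elim n)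
    then have "0 < 16 * l n * (1 + 1 / sqrt (g n)) / real n"
      using l0 by (intro divide_pos_pos mult_pos_pos add_pos_pos) auto
    then show ?case by (simp add: r_def)
  qed
  have r0: "r \<longlonglongrightarrow> 0"
  \<comment> \<open>Eventually \<open>L >= 1\<close>, so \<open>r\<close> is dominated by
    \<open>r * L\<close>.\<close>
  proof (rule tendsto_sandwich[OF _ _ tendsto_const rL])
    show "eventually (\<lambda>n. 0 \<le> r n) sequentially" using rpos by eventually_elim simp
    show "eventually (\<lambda>n. r n \<le> r n * L n) sequentially"
      using rpos ev by eventually_elim simp
  qed
  have "((\<lambda>n. 2 * exp (- real n * (r n)\<^sup>2 / 16) / \<alpha> n)) \<longlonglongrightarrow> 0"
  proof (rule tendsto_sandwich[OF _ _ tendsto_const])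
    show "eventually (\<lambda>n. 0 \<le> 2 * exp (- real n * (r n)\<^sup>2 / 16) / \<alpha> n) sequentially"
      using ev by eventually_elim simp
    \<comment> \<open>The summand \<open>1\<close> in the inflation factor reproduces
      \<open>\<alpha>\<close>, which cancels; the summand \<open>1 / sqrt g\<close> supplies the
      diverging exponent.\<close>
    show "eventually (\<lambda>n. 2 * exp (- real n * (r n)\<^sup>2 / 16) / \<alpha> n \<le> 2 * exp (- (l0 * (1 / sqrt (g n))))) sequentially"
      using ev
    proof eventually_elim
      case (elim n)
      have "0 \<le> 16 * l n * (1 + 1 / sqrt (g n)) / real n"
        using l0 elim by (intro divide_nonneg_nonneg mult_nonneg_nonneg add_nonneg_nonneg) auto
      then have "- real n * (r n)\<^sup>2 / 16 = - l n + - (l n * (1 / sqrt (g n)))"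
        using elim by (simp add: r_def field_simps)
      then have "exp (- real n * (r n)\<^sup>2 / 16) = \<alpha> n * exp (- (l n * (1 / sqrt (g n))))"
        using elim by (simp only: exp_add) (simp add: l_def ln_div)
      also have "\<dots> \<le> \<alpha> n * exp (- (l0 * (1 / sqrt (g n))))"
        using elim by (auto intro!: mult_left_mono divide_right_mono)
      finally show ?case using elim by (simp add: field_simps)
    qed
    have "filterlim (\<lambda>n. sqrt (g n)) (at_right 0) sequentially"
      unfolding filterlim_at
      using tendsto_real_sqrt[OF g0] ev by (auto elim: eventually_mono)
    then have "filterlim (\<lambda>n. l0 * (1 / sqrt (g n))) at_top sequentially"
      using filterlim_compose[OF filterlim_inverse_at_top_right]
      by (intro filterlim_tendsto_pos_mult_at_top[OF tendsto_const l0]) (simp add: inverse_eq_divide)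
    then have "filterlim (\<lambda>n. - (l0 * (1 / sqrt (g n)))) at_bot sequentially"
      by (simp add: filterlim_uminus_at_bot)
    from tendsto_mult_right_zero[OF filterlim_compose[OF exp_at_bot this], of 2]
    show "(\<lambda>n. 2 * exp (- (l0 * (1 / sqrt (g n))))) \<longlonglongrightarrow> 0" by simp
  qed
  moreover have "eventually (\<lambda>n. 0 < r n \<and> r n < 1) sequentially"
    using rpos order_tendstoD(2)[OF r0, of 1] by (simp add: eventually_conj)
  ultimately show ?thesis using r0 rL that unfolding L_def[abs_def] by blast
qed

text \<open>The range \<open>n >= 2\<close> is the one on which \<open>1 <= s < n\<close> is
  possible. The estimator is an arbitrary minimizer, perhaps not measurable in the sample, so the
  probability statement is phrased through a measurable event \<open>A\<close> on which the bounds
  hold.\<close>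

theorem corollary2:
  fixes p s :: "nat \<Rightarrow> nat"
    and x :: "nat \<Rightarrow> nat \<Rightarrow> nat \<Rightarrow> real"
    and \<beta>0 :: "nat \<Rightarrow> nat \<Rightarrow> real"
    and \<sigma> \<alpha> lam :: "nat \<Rightarrow> real"
    and M :: "nat \<Rightarrow> 'a measure"
    and \<epsilon> y :: "nat \<Rightarrow> nat \<Rightarrow> 'a \<Rightarrow> real"
    and \<beta>hat :: "nat \<Rightarrow> 'a \<Rightarrow> nat \<Rightarrow> real"
    and c cbar \<kappa> :: real
    and n0 :: nat
  assumes p_lim: "filterlim p at_top sequentially"
    and design: "\<And>n j. n \<ge> 2 \<Longrightarrow> j < p n \<Longrightarrow> emp_mean n (\<lambda>i. (x n i j)\<^sup>2) = 1"
    and sigma_pos: "\<And>n. n \<ge> 2 \<Longrightarrow> \<sigma> n > 0"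
    and sparsity: "\<And>n. n \<ge> 2 \<Longrightarrow> card (supp (p n) (\<beta>0 n)) = s n"
                  "\<And>n. n \<ge> 2 \<Longrightarrow> 1 \<le> s n \<and> s n < n"
    and prob: "\<And>n. n \<ge> 2 \<Longrightarrow> prob_space (M n)"
    and errors_indep:
      "\<And>n. n \<ge> 2 \<Longrightarrow> prob_space.indep_vars (M n) (\<lambda>_. borel) (\<epsilon> n) {..<n}"
    and errors_normal:
      "\<And>n i. n \<ge> 2 \<Longrightarrow> i < n \<Longrightarrow> distributed (M n) lborel (\<epsilon> n i) std_normal_density"
    and model: "\<And>n i \<omega>. n \<ge> 2 \<Longrightarrow> i < n \<Longrightarrow> \<omega> \<in> space (M n) \<Longrightarrow>
      y n i \<omega> = inner_p (p n) (x n i) (\<beta>0 n) + \<sigma> n * \<epsilon> n i \<omega>"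
    and level: "\<And>n. n \<ge> 2 \<Longrightarrow> 0 < \<alpha> n" "\<exists>a<1. \<forall>n\<ge>2. \<alpha> n \<le> a"
    and c: "c > 1"
    and cbar: "cbar = (c + 1) / (c - 1)"
    and RE: "n0 > 0" "\<kappa> > 0"
      "\<And>n. n > n0 \<Longrightarrow> re_kappa n (p n) (x n) (supp (p n) (\<beta>0 n)) cbar \<ge> \<kappa>"
      "\<And>n. n > n0 \<Longrightarrow> re_kappa_tilde n (p n) (x n) (supp (p n) (\<beta>0 n)) cbar \<ge> \<kappa>"
    and G: "(\<lambda>n. (ln (real (p n) / \<alpha> n))\<^sup>2 * ln (1 / \<alpha> n)) \<in> o(\<lambda>n. real n)"
      "filterlim (\<lambda>n. real (p n) / \<alpha> n) at_top sequentially"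
    and growth: "(\<lambda>n. real (s n) / real n * ln (real (p n) / \<alpha> n)) \<longlonglongrightarrow> 0"
    and penalty:
      "(\<forall>n\<ge>2. lam n = c * Lambda_Phi n (p n) (x n) (1 - \<alpha> n)) \<or>
       (\<forall>n\<ge>2. lam n = c * sqrt (real n) * inv std_normal_cdf (1 - \<alpha> n / (2 * real (p n))))"
    and estimator: "\<And>n \<omega>. n \<ge> 2 \<Longrightarrow> \<omega> \<in> space (M n) \<Longrightarrow>
      is_sqrt_lasso n (p n) (x n) (\<lambda>i. y n i \<omega>) (lam n) (\<beta>hat n \<omega>)"
  shows "\<exists>r q :: nat \<Rightarrow> real. r \<longlonglongrightarrow> 0 \<and> q \<in> o(\<alpha>) \<and>
    (\<forall>\<^sub>F n in sequentially. \<exists>A \<in> sets (M n). measure (M n) A \<ge> 1 - \<alpha> n - q n \<and>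
      (\<forall>\<omega>\<in>A. let \<delta> = (\<lambda>j. \<beta>hat n \<omega> j - \<beta>0 n j) in
        \<kappa> * l2_norm (p n) \<delta> \<le> pred_norm n (p n) (x n) \<delta> \<and>
        pred_norm n (p n) (x n) \<delta>
          \<le> 2 * (1 + c) / (\<kappa> * (1 - r n)) * \<sigma> n
              * sqrt (2 * real (s n) * ln (2 * real (p n) / \<alpha> n) / real n)))"
proof -
  obtain a where a: "a < 1" "\<And>n. n \<ge> 2 \<Longrightarrow> \<alpha> n \<le> a" using level(2) by blast
  have "a > 0" using a(2)[of 2] level(1)[of 2] by simp
  have ev_level: "eventually (\<lambda>n. 0 < \<alpha> n \<and> \<alpha> n \<le> a) sequentially"
    using eventually_ge_at_top[of 2] by eventually_elim (use level a in auto)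
  obtain r where r: "eventually (\<lambda>n. 0 < r n \<and> r n < 1) sequentially" "r \<longlonglongrightarrow> 0"
      "(\<lambda>n. r n * ln (real (p n) / \<alpha> n)) \<longlonglongrightarrow> 0"
      "(\<lambda>n. 2 * exp (- real n * (r n)\<^sup>2 / 16) / \<alpha> n) \<longlonglongrightarrow> 0"
    by (rule concentration_radius[OF ev_level \<open>a > 0\<close> a(1) G])
  define L where "L n = ln (real (p n) / \<alpha> n)" for n
  define W where "W n = ln (2 * real (p n) / \<alpha> n)" for n
  define tail where "tail n = 2 * exp (- real n * (r n)\<^sup>2 / 16) / \<alpha> n" for n
  \<comment> \<open>\<open>m\<close> is the inflation of the exact penalty over
    \<open>sqrt (2 * W)\<close>: it collects
    \<open>ln (4 * p / \<alpha>) = W * (1 + ln 2 / W)\<close> and the division by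
    \<open>1 - r\<close>.\<close>
  define m where "m n = sqrt ((1 + ln 2 / W n) / (1 - r n))" for n
  \<comment> \<open>\<open>h\<close> is the relative excess in
    \<open>score_stat_tail_normal_quantile\<close>, where \<open>w = 2 * W\<close>.\<close>
  define h where "h n = r n * (4 * W n + 1) * exp (r n * W n + 3 / 2)" for n
  define B where "B n = sqrt (2 * real (s n) * W n / real n)" for n
  \<comment> \<open>\<open>D\<close> is the absorption factor of the deterministic bound with
    \<open>\<rho>\<close> replaced by its upper bound. \<open>R\<close> is the final
    \<open>o(1)\<close> term, chosen so that \<open>1 / (1 - R)\<close> equals
    \<open>sqrt (1 + r) * m / D\<close>.\<close>
  define D where "D n = 1 - (cbar * (c / \<kappa> * (m n * B n)))\<^sup>2" for n
  define R where "R n = 1 - D n / (sqrt (1 + r n) * m n)" for n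

  have L_top: "filterlim L at_top sequentially"
    unfolding L_def[abs_def] by (rule filterlim_compose[OF ln_at_top G(2)])
  have p_pos: "eventually (\<lambda>n. p n > 0) sequentially"
  proof -
    have "eventually (\<lambda>n. 1 \<le> p n) sequentially" using p_lim by (simp add: filterlim_at_top)
    then show ?thesis by eventually_elim simp
  qed
  have W_eq: "eventually (\<lambda>n. W n = ln 2 + L n) sequentially"
    using p_pos ev_level
  proof eventually_elim
    case (elim n)
    then have "W n = ln (2 * (real (p n) / \<alpha> n))" by (simp add: W_def)
    also have "\<dots> = ln 2 + ln (real (p n) / \<alpha> n)" using elim by (subst ln_mult) auto
    finally show ?case by (simp add: L_def)
  qed
  have L1: "eventually (\<lambda>n. L n \<ge> 1) sequentially"
    using L_top by (simp add: filterlim_at_top)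
  have W_top: "filterlim W at_top sequentially"
    using filterlim_tendsto_add_at_top[OF tendsto_const L_top] by (subst filterlim_cong[OF refl refl W_eq])
  have W1: "eventually (\<lambda>n. W n \<ge> 1) sequentially"
    using W_top by (simp add: filterlim_at_top)
  have m1: "m \<longlonglongrightarrow> 1"
  proof -
    have "(\<lambda>n. ln 2 / W n) \<longlonglongrightarrow> 0"
      by (rule real_tendsto_divide_at_top[OF tendsto_const W_top])
    moreover have "(\<lambda>n. sqrt ((1 + v n) / (1 - r n))) \<longlonglongrightarrow> 1" if "v \<longlonglongrightarrow> 0" for v
      using that r(2) by (auto intro!: tendsto_eq_intros)
    ultimately show ?thesis unfolding m_def[abs_def] by blast
  qed
  have m_ge: "eventually (\<lambda>n. m n \<ge> 1) sequentially"
    using r(1) W1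
  proof eventually_elim
    case (elim n)
    then have "0 \<le> ln 2 / W n" by simp
    then have "1 - r n \<le> 1 + ln 2 / W n" using elim by linarith
    then show ?case using elim by (simp add: m_def)
  qed
  have rW: "(\<lambda>n. r n * W n) \<longlonglongrightarrow> 0"
  proof (rule Lim_transform_eventually)
    show "(\<lambda>n. r n * ln 2 + r n * L n) \<longlonglongrightarrow> 0"
      using tendsto_add[OF tendsto_mult_left_zero[OF r(2)] r(3)] by (simp add: L_def)
    show "eventually (\<lambda>n. r n * ln 2 + r n * L n = r n * W n) sequentially"
      using W_eq by eventually_elim (simp add: algebra_simps)
  qed
  have h0: "h \<longlonglongrightarrow> 0"
  proof -
    have "(\<lambda>n. (4 * (r n * W n) + r n) * exp (r n * W n + 3 / 2)) \<longlonglongrightarrow> 0"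
    proof -
      have "(\<lambda>n. (4 * v n + r n) * exp (v n + 3 / 2)) \<longlonglongrightarrow> 0" if "v \<longlonglongrightarrow> 0" for v
        using that r(2) by (auto intro!: tendsto_eq_intros)
      from this[OF rW] show ?thesis .
    qed
    then show ?thesis by (simp add: h_def[abs_def] algebra_simps)
  qed
  have B0: "B \<longlonglongrightarrow> 0"
  proof -
    have sL: "(\<lambda>n. real (s n) / real n * L n) \<longlonglongrightarrow> 0" using growth by (simp add: L_def)
    \<comment> \<open>As \<open>L >= 1\<close> eventually, the bare ratio \<open>s / n\<close> is
      dominated by \<open>s / n * L\<close>, so the extra \<open>ln 2\<close> in \<open>W\<close> is
      harmless.\<close>
    have sn: "(\<lambda>n. real (s n) / real n) \<longlonglongrightarrow> 0"
    proof (rule tendsto_sandwich[OF _ _ tendsto_const sL])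
      show "eventually (\<lambda>n. real (s n) / real n \<le> real (s n) / real n * L n) sequentially"
        using L1
      proof eventually_elim
        case (elim n)
        then show ?case using mult_left_mono[OF elim, of "real (s n) / real n"] by simp
      qed
    qed simp
    have "(\<lambda>n. sqrt (2 * (real (s n) / real n * ln 2 + real (s n) / real n * L n))) \<longlonglongrightarrow> 0"
    proof -
      have "(\<lambda>n. sqrt (2 * (v n * ln 2 + w n))) \<longlonglongrightarrow> 0" if "v \<longlonglongrightarrow> 0" "w \<longlonglongrightarrow> 0" for v w
        using that by (auto intro!: tendsto_eq_intros)
      from this[OF sn sL] show ?thesis .
    qed
    moreover have "eventually (\<lambda>n. sqrt (2 * (real (s n) / real n * ln 2 + real (s n) / real n * L n)) = B n) sequentially"
      using W_eq by eventually_elim (simp add: B_def algebra_simps add_divide_distrib)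
    ultimately show ?thesis by (rule Lim_transform_eventually)
  qed
  have D1: "D \<longlonglongrightarrow> 1"
    unfolding D_def[abs_def] using m1 B0 RE(2) by (auto intro!: tendsto_eq_intros)
  have R0: "R \<longlonglongrightarrow> 0"
    unfolding R_def[abs_def] using D1 m1 r(2) by (auto intro!: tendsto_eq_intros)
  have D_pos: "eventually (\<lambda>n. D n > 0) sequentially"
    using order_tendstoD(1)[OF D1, of 0] by simp
  have tail0: "tail \<longlonglongrightarrow> 0" using r(4) by (simp add: tail_def[abs_def])
  have tail_small: "eventually (\<lambda>n. tail n \<le> 1 / 2) sequentially"
    using order_tendstoD(2)[OF tail0, of "1 / 2"] by (auto elim: eventually_mono)

  \<comment> \<open>Relative to \<open>\<alpha>\<close>, the excess failure probability is
    \<open>h\<close> and one \<open>tail\<close> from the penalty, and a second \<open>tail\<close>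
    from the noise level.\<close>
  have "eventually (\<lambda>n. \<exists>A\<in>sets (M n). 1 - \<alpha> n - \<alpha> n * (h n + 2 * tail n) \<le> measure (M n) A \<and>
      (\<forall>\<omega>\<in>A. let \<delta> = (\<lambda>j. \<beta>hat n \<omega> j - \<beta>0 n j) in
        \<kappa> * l2_norm (p n) \<delta> \<le> pred_norm n (p n) (x n) \<delta> \<and>
        pred_norm n (p n) (x n) \<delta> \<le> 2 * (1 + c) / (\<kappa> * (1 - R n)) * \<sigma> n * B n)) sequentially"
    using eventually_ge_at_top[of 2] eventually_gt_at_top[of n0] ev_level p_pos r(1) L1 W1 m_ge D_pos tail_small
  proof eventually_elim
    case (elim n)
    interpret prob_space "M n" using prob elim by simp
    have n: "n \<ge> 2" "n > 0" and p: "p n > 0" and \<alpha>: "0 < \<alpha> n" "\<alpha> n < 1" and rn: "0 < r n" "r n < 1"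
      using elim a(1) by auto
    have W: "W n \<ge> 1" and m: "m n \<ge> 1" using elim by auto
    have tail: "2 * exp (- real n * (r n)\<^sup>2 / 16) = \<alpha> n * tail n"
      using \<alpha> by (simp add: tail_def)
    have tail_nn: "0 \<le> tail n" using \<alpha> by (simp add: tail_def)
    have h_nn: "0 \<le> h n" using rn W by (simp add: h_def)
    note indep = errors_indep[OF n(1)] and normal = errors_normal[OF n(1)] and design_n = design[OF n(1)]
    define t where "t = inv std_normal_cdf (1 - \<alpha> n / (2 * real (p n)))"
    \<comment> \<open>A common form for the two options: the exact penalty needs the factor
      \<open>m\<close> in size, whereas the asymptotic one stays below
      \<open>sqrt (n) * sqrt (2 * W)\<close> and pays \<open>h\<close> and \<open>tail\<close> in
      probability.\<close>
    have pen: "0 < lam n / c \<and> lam n / c \<le> sqrt (real n) * (sqrt (2 * W n) * m n) \<and>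
      prob {\<omega> \<in> space (M n). score_stat n (p n) (x n) (\<lambda>i. \<epsilon> n i \<omega>) > lam n / c} \<le> \<alpha> n * (1 + h n + tail n)"
      using penalty
    proof
      assume "\<forall>n\<ge>2. lam n = c * Lambda_Phi n (p n) (x n) (1 - \<alpha> n)"
      then have lam: "lam n / c = Lambda_Phi n (p n) (x n) (1 - \<alpha> n)" using n c by simp
      note ex = exact_penalty[where x="x n", OF indep normal design_n n(2) p \<alpha>, folded lam]
      have "4 * real (p n) / \<alpha> n = 2 * (2 * real (p n) / \<alpha> n)" by simp
      also have "ln \<dots> = ln 2 + W n"
        unfolding W_def using p \<alpha> by (subst ln_mult) auto
      also have "ln 2 + W n = W n * (1 + ln 2 / W n)" using W by (simp add: distrib_left)
      finally have "2 * ln (4 * real (p n) / \<alpha> n) / (1 - r n) = 2 * W n * ((1 + ln 2 / W n) / (1 - r n))"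
        by simp
      then have "sqrt (2 * ln (4 * real (p n) / \<alpha> n) / (1 - r n)) = sqrt (2 * W n) * m n"
        by (simp only: m_def real_sqrt_mult)
      \<comment> \<open>This is the condition on the radius in the upper bound of
        \<open>exact_penalty\<close>.\<close>
      moreover have "\<alpha> n * tail n \<le> \<alpha> n * (1 / 2)"
        using elim \<alpha> by (intro mult_left_mono) auto
      ultimately have "lam n / c \<le> sqrt (real n) * (sqrt (2 * W n) * m n)"
        using ex(3)[OF _ _ rn] tail by simp
      moreover have "\<alpha> n \<le> \<alpha> n * (1 + h n + tail n)"
        using \<alpha> h_nn tail_nn by simp
      ultimately show ?thesis using ex(1,2) by (auto intro: order_trans)
    next
      assume "\<forall>n\<ge>2. lam n = c * sqrt (real n) * inv std_normal_cdf (1 - \<alpha> n / (2 * real (p n)))"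
      then have lam: "lam n / c = sqrt (real n) * t" using n c by (simp add: t_def)
      note t = normal_quantile_penalty[OF p \<alpha>, folded t_def W_def]
      have "t = sqrt (t\<^sup>2)" using t(1) by simp
      also have "\<dots> \<le> sqrt (2 * W n)" using t(3) by (rule real_sqrt_le_mono)
      also have "\<dots> \<le> sqrt (2 * W n) * m n" using m W by (simp add: mult_le_cancel_left1)
      finally have "sqrt (real n) * t \<le> sqrt (real n) * (sqrt (2 * W n) * m n)"
        by (rule mult_left_mono) simp
      moreover have "prob {\<omega> \<in> space (M n). score_stat n (p n) (x n) (\<lambda>i. \<epsilon> n i \<omega>) > sqrt (real n) * t}
          \<le> \<alpha> n * (1 + h n) + \<alpha> n * tail n"
        using score_stat_tail_normal_quantile[where x="x n", OF indep normal design_n n(2) p \<alpha> rn]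
        unfolding tail by (simp add: t_def h_def W_def)
      ultimately show ?thesis unfolding lam using t(1) n by (simp add: algebra_simps)
    qed
    define \<rho> where "\<rho> = lam n * sqrt (real (card (supp (p n) (\<beta>0 n)))) / (real n * \<kappa>)"
    have lam_pos: "lam n > 0" using pen c by (simp add: zero_less_divide_iff)
    obtain A where A: "A \<in> sets (M n)"
        "1 - \<alpha> n * (1 + h n + tail n) - \<alpha> n * tail n \<le> prob A"
        "\<And>\<omega>. \<omega> \<in> A \<Longrightarrow> \<kappa> * l2_norm (p n) (\<lambda>j. \<beta>hat n \<omega> j - \<beta>0 n j)
          \<le> pred_norm n (p n) (x n) (\<lambda>j. \<beta>hat n \<omega> j - \<beta>0 n j)"
        "\<And>\<omega>. \<omega> \<in> A \<Longrightarrow> (1 - (cbar * \<rho>)\<^sup>2) * pred_norm n (p n) (x n) (\<lambda>j. \<beta>hat n \<omega> j - \<beta>0 n j)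
          \<le> 2 * (1 + 1 / c) * (\<sigma> n * sqrt (1 + r n)) * \<rho>"
      using sqrt_lasso_error_probability[OF n(2) p sigma_pos[OF n(1)] RE(2) lam_pos c cbar indep normal
          model[OF n(1)] estimator[OF n(1)] RE(3,4)[OF elim(2)] _ rn(1) less_imp_le[OF rn(2)],
          folded \<rho>_def, unfolded tail] pen
      by blast
    have "\<rho> = lam n / c * (c * sqrt (real (s n)) / (real n * \<kappa>))"
      using c sparsity(1)[OF n(1)] by (simp add: \<rho>_def)
    also have "\<dots> \<le> sqrt (real n) * (sqrt (2 * W n) * m n) * (c * sqrt (real (s n)) / (real n * \<kappa>))"
      using pen c RE(2) by (intro mult_right_mono) auto
    also have "\<dots> = c / \<kappa> * (m n * (sqrt (2 * W n) * sqrt (real (s n)) * (sqrt (real n) / real n)))"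
      by (simp add: field_simps)
    also have "sqrt (2 * W n) * sqrt (real (s n)) * (sqrt (real n) / real n) = B n"
    proof -
      have "sqrt (real n) / real n = sqrt (1 / real n)"
        using n by (simp add: real_sqrt_divide real_div_sqrt field_simps)
      then show ?thesis
        by (simp only: B_def real_sqrt_mult[symmetric]) (simp add: mult_ac)
    qed
    finally have \<rho>_le: "\<rho> \<le> c / \<kappa> * (m n * B n)" .
    have \<rho>_nn: "0 \<le> \<rho>" using lam_pos RE(2) by (simp add: \<rho>_def)
    have "0 \<le> cbar" using c cbar by simp
    then have "(cbar * \<rho>)\<^sup>2 \<le> (cbar * (c / \<kappa> * (m n * B n)))\<^sup>2"
      using \<rho>_le \<rho>_nn by (intro power_mono mult_left_mono) auto
    then have D_le: "D n \<le> 1 - (cbar * \<rho>)\<^sup>2" by (simp add: D_def)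
    have "pred_norm n (p n) (x n) (\<lambda>j. \<beta>hat n \<omega> j - \<beta>0 n j) \<le> 2 * (1 + c) / (\<kappa> * (1 - R n)) * \<sigma> n * B n"
      if "\<omega> \<in> A" for \<omega>
    proof -
      let ?N = "pred_norm n (p n) (x n) (\<lambda>j. \<beta>hat n \<omega> j - \<beta>0 n j)"
      have "D n * ?N \<le> (1 - (cbar * \<rho>)\<^sup>2) * ?N"
        using D_le pred_norm_nonneg by (rule mult_right_mono)
      also have "\<dots> \<le> 2 * (1 + 1 / c) * (\<sigma> n * sqrt (1 + r n)) * \<rho>" by (rule A(4)[OF that])
      also have "\<dots> \<le> 2 * (1 + 1 / c) * (\<sigma> n * sqrt (1 + r n)) * (c / \<kappa> * (m n * B n))"
        using \<rho>_le c rn sigma_pos[OF n(1)] by (intro mult_left_mono) auto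
      \<comment> \<open>The factor \<open>c\<close> of the penalty turns \<open>1 + 1 / c\<close>
        into \<open>1 + c\<close>.\<close>
      also have "\<dots> = 2 * (1 + c) / \<kappa> * (sqrt (1 + r n) * m n) * \<sigma> n * B n"
        using c RE(2) by (simp add: field_simps)
      finally have "?N \<le> 2 * (1 + c) / \<kappa> * (sqrt (1 + r n) * m n) * \<sigma> n * B n / D n"
        using elim by (subst pos_le_divide_eq) (simp_all only: mult.commute[of "D n"])
      also have "\<dots> = 2 * (1 + c) / (\<kappa> * (1 - R n)) * \<sigma> n * B n"
        by (simp add: R_def)
      finally show ?thesis .
    qed
    moreover have "1 - \<alpha> n - \<alpha> n * (h n + 2 * tail n) \<le> prob A"
      using A(2) by (simp add: algebra_simps)
    ultimately show ?case using A(1,3) by (auto simp: Let_def intro!: bexI[of _ A])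
  qed
  moreover have "(\<lambda>n. \<alpha> n * (h n + 2 * tail n)) \<in> o(\<alpha>)"
  proof -
    have "(\<lambda>n. h n + 2 * tail n) \<longlonglongrightarrow> 0"
      using h0 tail0 by (auto intro!: tendsto_eq_intros)
    then have "(\<lambda>n. h n + 2 * tail n) \<in> o(\<lambda>_. 1)" by (intro smalloI_tendsto) auto
    then show ?thesis using landau_o.small.mult_left[of "\<lambda>n. h n + 2 * tail n" _ "\<lambda>_. 1" \<alpha>] by simp
  qed
  ultimately show ?thesis
    using R0 by (intro exI[of _ R] exI[of _ "\<lambda>n. \<alpha> n * (h n + 2 * tail n)"]) (simp add: B_def W_def)
qed

end
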